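(* Consider the algorithm described in the context, where $\psi$ can be truncated, and suppose it does not terminate in finitely many steps. Assume: (A.1) $\psi$ is bounded from below; (B.1) there is $R>0$ with $\{x^k\}\subseteq B_R(0)$; (B.2) there is $\kappa_B>0$ with $\sup_k\|B^k\|\le\kappa_B$; (B.3) for every subsequence $\{k_\ell\}$ such that $\{x^{k_\ell}\}$ converges and $\alpha_{k_\ell}\to0$, $\psi(x^{k_\ell}+\alpha_{k_\ell}\bar s^{k_\ell})-\psi(x^{k_\ell})-\alpha_{k_\ell}\psi'(x^{k_\ell};\bar s^{k_\ell})=o(\alpha_{k_\ell})$ as $\ell\to\infty$; (B.4) for every $\epsilon>0$ there is $\epsilon'>0$ such that $\Gamma(x^k)\ge\epsilon$ implies $\Gamma(x^k,\bar s^k)\ge\epsilon'$. Then $\liminf_{k\to\infty}\|g^k\|=0$.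
   Context: Problem: minimize $\psi=f+\varphi$ where $f:\mathbb{R}^n\to\mathbb{R}$ is continuously differentiable and $\varphi:\mathbb{R}^n\to\mathbb{R}$ is convex. Notation: $\|\cdot\|$ Euclidean norm (Frobenius for matrices), $B_r(x)$ open ball, $\bar v=v/\|v\|$, $\psi'(x;d)$ directional derivative, $\partial\psi(x)=\nabla f(x)+\partial\varphi(x)$; $x$ is stationary if $0\in\partial\psi(x)$. Pseudo-gradient: $g(x)=u(x)d(x)$ where, for non-stationary $x$, $\|d(x)\|=1$, $\psi'(x;d(x))<0$, $u(x)\in[\psi'(x;d(x)),0)$, and for stationary $x$, $d(x)=0$, $u(x)=0$. Safeguards: for $\|d\|=1$, $\Gamma_{\max}(x,d)=\sup\{T>0: t\mapsto\psi(x+td)\text{ is } C^1\text{ on }(0,T)\}$, $\Gamma(x)=\inf_{\|d\|=1}\Gamma_{\max}(x,d)$; a stepsize safeguard $(x,d)\mapsto\Gamma(x,d)\in(0,\infty]$ is fixed. Truncation: $\psi$ can be truncated with data $\mathbb{R}^n=S_0\supset\cdots\supset S_m$, $\delta\in(0,\infty]$, $\kappa>0$, $T:\mathbb{R}^n\times(0,\delta]\to\mathbb{R}^n$ meaning (i) $\Gamma(x)\ge\delta$ on $S_m$; (ii) for $a\in(0,\delta]$, $x\in S_i\setminus S_{i+1}$, $i<m$: if $\Gamma(x)\ge a$ then $T(x,a)=x$, else $T(x,a)\in S_{i+1}$, $\Gamma(T(x,a))\ge a$, $\|T(x,a)-x\|\le\kappa a$. Put $S_{m+1}=\emptyset$.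 Algorithm: parameters $0<\eta<\eta_1<\eta_2<1$, $0<r_1<1<r_2$, $\Delta_{\max}>0$, $\gamma_1,\gamma_2>0$, a positive strictly decreasing summable sequence $(\epsilon_s)$ with $\epsilon_s\le\delta$, a nonincreasing $\ell:(0,\infty)\to[0,\frac12]$ with $\ell(\Delta)\to0$ as $\Delta\to0^+$; start $x^0$, $\Delta_0>0$, counters $c_0=\dots=c_m=0$. Iteration $k$: $g^k=g(x^k)$; stop if $g^k=0$. Choose $B^k\in\mathbb{R}^{n\times n}$, model $m_k(s)=\psi(x^k)+\langle g^k,s\rangle+\frac12\langle s,B^ks\rangle$, Cauchy point $s^k_C=-\alpha^C_kg^k$ with $\alpha^C_k\in\arg\min_{0\le t\le\Delta_k/\|g^k\|}m_k(-tg^k)$. Choose $s^k$, $\|s^k\|\le\Delta_k$, with $m_k(0)-m_k(s^k)\ge\frac{\gamma_1}{2}\|g^k\|\min\{\Delta_k,\gamma_2\|g^k\|\}$ and $m_k(0)-m_k(s^k)\ge(1-\ell(\|s^k\|))(m_k(0)-m_k(s^k_C))$. Let $\rho^1_k=\frac{\psi(x^k)-\psi(x^k+s^k)}{m_k(0)-m_k(s^k)}$. If $\rho^1_k\ge\eta_1$: $\tilde x^k=x^k+s^k$, $\Delta_{k+1}=\min\{\Delta_{\max},r_2\Delta_k\}$ if $\rho^1_k>\eta_2$ and $\Delta_{k+1}=\Delta_k$ otherwise. Stepsize computation (performed for the analysis in every iteration, used by the algorithm when $\rho^1_k<\eta_1$): $\alpha_k=\min\{\Gamma(x^k,\bar s^k),\|s^k\|\}$;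 if $m_k(0)-m_k(\alpha_k\bar s^k)<\frac{\alpha_k}{2\|s^k\|}(m_k(0)-m_k(s^k))$, replace $s^k$ by $s^k_C$ and $\alpha_k=\min\{\Gamma(x^k,\bar s^k_C),\|s^k_C\|\}$; $\rho^2_k=\frac{\psi(x^k)-\psi(x^k+\alpha_k\bar s^k)}{m_k(0)-m_k(\alpha_k\bar s^k)}$. If $\rho^1_k<\eta_1$: $\Delta_{k+1}=r_1\Delta_k$ if $\rho^2_k<\eta_1$, $=\min\{\Delta_{\max},r_2\Delta_k\}$ if $\rho^2_k>\eta_2$, $=\Delta_k$ otherwise; $\tilde x^k=x^k+\alpha_k\bar s^k$ if $\rho^2_k\ge\eta$ and $\tilde x^k=x^k$ otherwise. Truncation step: set $\tilde x=\tilde x^k$ and repeat {find $i$ with $\tilde x\in S_i\setminus S_{i+1}$; if $\Gamma(\tilde x)<\epsilon_{c_i}$ set $\tilde x\leftarrow T(\tilde x,\epsilon_{c_i})$, $c_i\leftarrow c_i+1$; else stop}; $x^{k+1}=\tilde x$. Here $\alpha_k,\bar s^k$ denote the quantities of the stepsize computation. *)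

theory Defs
  imports "HOL-Analysis.Analysis" "HOL-Library.Landau_Symbols"
begin

text \<open>Convex subdifferential of a convex function at x.\<close>
definition convex_subdiff :: "('a::real_inner \<Rightarrow> real) \<Rightarrow> 'a \<Rightarrow> 'a set" where
  "convex_subdiff phi x = {v. \<forall>y. phi y \<ge> phi x + v \<bullet> (y - x)}"

text \<open>x is stationary for psi = f + phi: 0 in grad f(x) + subdifferential of phi at x.\<close>
definition stationary :: "('a::real_inner \<Rightarrow> 'a) \<Rightarrow> ('a \<Rightarrow> real) \<Rightarrow> 'a \<Rightarrow> bool" where
  "stationary gradf phi x \<longleftrightarrow> 0 \<in> (\<lambda>v. gradf x + v) ` convex_subdiff phi x"

text \<open>One-sided directional derivative psi'(x;d).\<close>
definition dir_deriv :: "('a::real_normed_vector \<Rightarrow> real) \<Rightarrow> 'a \<Rightarrow> 'a \<Rightarrow> real" where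
  "dir_deriv psi x d = Lim (at_right 0) (\<lambda>t. (psi (x + t *\<^sub>R d) - psi x) / t)"

text \<open>Gamma_max(x,d) = sup{T>0 : t -> psi(x+td) is C^1 on (0,T)} (in (0,\<infinity>]).\<close>
definition Gamma_max :: "('a::real_normed_vector \<Rightarrow> real) \<Rightarrow> 'a \<Rightarrow> 'a \<Rightarrow> ereal" where
  "Gamma_max psi x d =
     (SUP T \<in> {T. T > 0 \<and> (\<lambda>t. psi (x + t *\<^sub>R d)) C1_differentiable_on {0<..<T}}. ereal T)"

text \<open>Gamma(x) = inf over unit directions of Gamma_max(x,d).\<close>
definition Gamma_pt :: "('a::real_normed_vector \<Rightarrow> real) \<Rightarrow> 'a \<Rightarrow> ereal" where
  "Gamma_pt psi x = (INF d \<in> {d. norm d = 1}. Gamma_max psi x d)"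

text \<open>Trust-region model m_k(s).\<close>
definition tr_model :: "real \<Rightarrow> real^'n \<Rightarrow> real^'n^'n \<Rightarrow> real^'n \<Rightarrow> real" where
  "tr_model psix g B s = psix + g \<bullet> s + 1/2 * (s \<bullet> (B *v s))"

text \<open>The truncation property, with S_(m+1) = {} put explicitly.\<close>
definition can_truncate ::
  "('a::real_normed_vector \<Rightarrow> ereal) \<Rightarrow> (nat \<Rightarrow> 'a set) \<Rightarrow> nat \<Rightarrow> ereal \<Rightarrow> real
    \<Rightarrow> ('a \<Rightarrow> real \<Rightarrow> 'a) \<Rightarrow> bool" where
  "can_truncate Gam S m \<delta> \<kappa> T \<longleftrightarrow>
     S 0 = UNIV \<and> (\<forall>i<m. S (Suc i) \<subseteq> S i) \<and> S (Suc m) = {} \<and>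
     0 < \<delta> \<and> 0 < \<kappa> \<and>
     (\<forall>x\<in>S m. \<delta> \<le> Gam x) \<and>
     (\<forall>a i x. 0 < a \<and> ereal a \<le> \<delta> \<and> i < m \<and> x \<in> S i - S (Suc i) \<longrightarrow>
        (if ereal a \<le> Gam x then T x a = x
         else T x a \<in> S (Suc i) \<and> ereal a \<le> Gam (T x a) \<and> norm (T x a - x) \<le> \<kappa> * a))"

text \<open>The index i with x in S_i minus S_(i+1).\<close>
definition level :: "(nat \<Rightarrow> 'a set) \<Rightarrow> nat \<Rightarrow> 'a \<Rightarrow> nat" where
  "level S m x = (SOME i. i \<le> m \<and> x \<in> S i \<and> x \<notin> S (Suc i))"

text \<open>trunc_loop ... x c x' c': the truncation loop started at point x with counters c
  terminates with point x' and counters c'.\<close>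
inductive trunc_loop ::
  "('a \<Rightarrow> ereal) \<Rightarrow> (nat \<Rightarrow> 'a set) \<Rightarrow> nat \<Rightarrow> (nat \<Rightarrow> real) \<Rightarrow> ('a \<Rightarrow> real \<Rightarrow> 'a)
    \<Rightarrow> 'a \<Rightarrow> (nat \<Rightarrow> nat) \<Rightarrow> 'a \<Rightarrow> (nat \<Rightarrow> nat) \<Rightarrow> bool"
  for Gam S m eps T where
  stop: "\<not> Gam x < ereal (eps (c (level S m x))) \<Longrightarrow> trunc_loop Gam S m eps T x c x c"
| step: "Gam x < ereal (eps (c (level S m x))) \<Longrightarrow>
         trunc_loop Gam S m eps T (T x (eps (c (level S m x))))
            (c(level S m x := Suc (c (level S m x)))) x' c' \<Longrightarrow>
         trunc_loop Gam S m eps T x c x' c'"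

end

theory Submission
  imports Defs
begin

text \<open>Suppose that \<open>norm (g k) \<ge> ep > 0\<close> for all large \<open>k\<close>. Add to \<open>psi (x k)\<close> the price
  \<open>L \<kappa>\<close> times the tails \<open>\<Sum>j. \<epsilon> (j + c k i)\<close> of the truncation sequence at the current counters:
  a truncation with parameter \<open>\<epsilon> (c k i)\<close> raises \<open>psi\<close> by at most \<open>L \<kappa> \<epsilon> (c k i)\<close> and lowers the
  tail by exactly \<open>\<epsilon> (c k i)\<close>, so this merit function falls at least by the actual decrease of
  \<open>psi\<close> in every iteration, and as \<open>psi\<close> is bounded below the actual decreases tend to \<open>0\<close>.
  Hence eventually no trial step is successful. By (B.3) the directional step is very successful
  for small radii, so the radius stays bounded below. The stopping rule of the truncation loop
  keeps \<open>Gamma_pt psi (x k)\<close> from tending to \<open>0\<close>, and by (B.4) the directional steps at iterates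
  where it is at least \<open>e\<close> are long; so eventually all of them are rejected. From such an iterate
  on, the algorithm stays put and shrinks the radius geometrically, a contradiction.\<close>

section \<open>Analytic preliminaries\<close>

lemma convex_on_lipschitz_on_cball:
  fixes phi :: "'a::euclidean_space \<Rightarrow> real"
  assumes cv: "convex_on UNIV phi"
  obtains L where "L-lipschitz_on (cball 0 r) phi"
proof -
  have "compact (phi ` cball 0 (r + 1))"
    by (intro compact_continuous_image continuous_on_subset[OF convex_on_continuous[OF open_UNIV cv]])
      auto
  then obtain M where M_pos: "M > 0" and "\<forall>y \<in> phi ` cball 0 (r + 1). norm y \<le> M"
    using compact_imp_bounded bounded_pos by metis
  then have M: "\<And>z. z \<in> cball 0 (r + 1) \<Longrightarrow> \<bar>phi z\<bar> \<le> M" by simp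
  have one_sided: "phi y - phi x \<le> 2 * M * norm (y - x)"
    if x: "x \<in> cball 0 r" and y: "y \<in> cball 0 r" and "x \<noteq> y" for x y
  proof -
    define n where "n = norm (y - x)"
    have n: "0 < n" using \<open>x \<noteq> y\<close> by (simp add: n_def)
    \<comment> \<open>y lies on the segment from x to the point z at distance 1 beyond y\<close>
    define z where "z = y + (1/n) *\<^sub>R (y - x)"
    define \<theta> where "\<theta> = n / (n + 1)"
    have "norm z \<le> norm y + 1"
      using norm_triangle_ineq[of y "(1/n) *\<^sub>R (y - x)"] n by (simp add: z_def n_def)
    then have z: "z \<in> cball 0 (r + 1)" using y by simp
    have "(1 - \<theta>) *\<^sub>R x + \<theta> *\<^sub>R z = y"
      using n by (simp add: \<theta>_def z_def field_simps algebra_simps scaleR_add_left[symmetric]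
          del: scaleR_add_left)
    then have "phi y \<le> (1 - \<theta>) * phi x + \<theta> * phi z"
      using convex_onD[OF cv, of \<theta> x z] n by (simp add: \<theta>_def)
    then have "phi y - phi x \<le> \<theta> * (phi z - phi x)" by (simp add: algebra_simps)
    also have "\<dots> \<le> \<theta> * (2 * M)"
      using M[OF z] M[of x] x n by (intro mult_left_mono) (auto simp: \<theta>_def)
    also have "\<dots> \<le> n * (2 * M)"
      using M[OF z] n by (intro mult_right_mono) (auto simp: \<theta>_def field_simps)
    finally show ?thesis by (simp add: n_def mult.commute)
  qed
  have "(2 * M)-lipschitz_on (cball 0 r) phi"
  proof (rule lipschitz_onI)
    show "0 \<le> 2 * M" using M_pos by simp
    fix x y :: 'a assume "x \<in> cball 0 r" "y \<in> cball 0 r"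
    then show "dist (phi x) (phi y) \<le> 2 * M * dist x y"
      using one_sided[of x y] one_sided[of y x]
      by (cases "x = y") (auto simp: dist_real_def dist_norm norm_minus_commute)
  qed
  then show thesis by (rule that)
qed

lemma gradient_lipschitz_on_compact_convex:
  fixes f :: "'a::euclidean_space \<Rightarrow> real"
  assumes der: "\<And>y. (f has_derivative (\<lambda>h. gradf y \<bullet> h)) (at y)"
    and cont: "continuous_on UNIV gradf"
    and S: "compact S" "convex S"
  obtains L where "L-lipschitz_on S f"
proof -
  have "compact (gradf ` S)"
    using S by (intro compact_continuous_image continuous_on_subset[OF cont]) auto
  then obtain M where M_pos: "M > 0" and "\<forall>y \<in> gradf ` S. norm y \<le> M"
    using compact_imp_bounded bounded_pos by metis
  then have M: "\<And>z. z \<in> S \<Longrightarrow> norm (gradf z) \<le> M" by simp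
  have "M-lipschitz_on S f"
  proof (rule lipschitz_onI)
    fix x y assume "x \<in> S" "y \<in> S"
    have "norm (f x - f y) \<le> M * norm (x - y)"
    proof (rule differentiable_bound[OF S(2) _ _ \<open>x \<in> S\<close> \<open>y \<in> S\<close>])
      fix z assume "z \<in> S"
      show "(f has_derivative (\<lambda>h. gradf z \<bullet> h)) (at z within S)"
        using der has_derivative_at_withinI by blast
      show "onorm (\<lambda>h. gradf z \<bullet> h) \<le> M"
        using M[OF \<open>z \<in> S\<close>]
        by (intro onorm_le) (metis Cauchy_Schwarz_ineq2 mult_right_mono norm_ge_zero order_trans
            real_norm_def)
    qed
    then show "dist (f x) (f y) \<le> M * dist x y" by (simp add: dist_norm)
  qed (use M_pos in simp)
  then show thesis by (rule that)
qed

lemma convex_on_ray: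
  assumes "convex_on UNIV phi"
  shows "convex_on UNIV (\<lambda>t::real. phi (x + t *\<^sub>R v))"
proof (rule convex_onI)
  fix s t \<mu> :: real assume "0 < \<mu>" "\<mu> < 1"
  have "x + ((1 - \<mu>) *\<^sub>R s + \<mu> *\<^sub>R t) *\<^sub>R v = (1 - \<mu>) *\<^sub>R (x + s *\<^sub>R v) + \<mu> *\<^sub>R (x + t *\<^sub>R v)"
    by (simp add: algebra_simps)
  then show "phi (x + ((1 - \<mu>) *\<^sub>R s + \<mu> *\<^sub>R t) *\<^sub>R v)
      \<le> (1 - \<mu>) * phi (x + s *\<^sub>R v) + \<mu> * phi (x + t *\<^sub>R v)"
    using convex_onD[OF assms] \<open>0 < \<mu>\<close> \<open>\<mu> < 1\<close> by simp
qed simp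

lemma convex_on_ray_slope_mono:
  assumes "convex_on UNIV phi" "0 < a" "a \<le> b"
  shows "(phi (x + a *\<^sub>R v) - phi x) / a \<le> (phi (x + b *\<^sub>R v) - phi x) / b"
proof (cases "a = b")
  case False
  then show ?thesis
    using convex_on_slope_le(1)[OF convex_on_ray[OF assms(1), of x v], of 0 b a] assms
    by (auto simp: field_simps)
qed simp

lemma convex_on_ray_slope_lower_bound:
  assumes "convex_on UNIV phi" "0 < a"
  shows "phi x - phi (x - v) \<le> (phi (x + a *\<^sub>R v) - phi x) / a"
proof -
  note slope = convex_on_slope_le[OF convex_on_ray[OF assms(1), of x v], of "-1" a 0]
  show ?thesis
    using slope assms(2) by (simp add: minus_divide_left)
qed

lemma dir_deriv_eqI:
  assumes "((\<lambda>t. (psi (x + t *\<^sub>R v) - psi x) / t) \<longlongrightarrow> l) (at_right 0)"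
  shows "dir_deriv psi x v = l"
  unfolding dir_deriv_def using assms by (rule tendsto_Lim[rotated]) simp

lemma dir_deriv_zero_direction: "dir_deriv psi x 0 = 0"
  by (rule dir_deriv_eqI) simp

lemma dir_deriv_smooth_plus_convex:
  fixes f phi :: "'a::real_normed_vector \<Rightarrow> real"
  assumes der: "(f has_derivative f') (at x)" and cv: "convex_on UNIV phi"
  defines "psi \<equiv> \<lambda>y. f y + phi y"
  shows "((\<lambda>t. (psi (x + t *\<^sub>R v) - psi x) / t) \<longlongrightarrow> dir_deriv psi x v) (at_right 0)"
proof -
  have "((\<lambda>t. x + t *\<^sub>R v) has_derivative (\<lambda>t. t *\<^sub>R v)) (at 0)"
    by (auto intro!: derivative_eq_intros)
  from has_derivative_compose[OF this, of f f'] der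
  have "((\<lambda>t. f (x + t *\<^sub>R v)) has_derivative (\<lambda>t. f' (t *\<^sub>R v))) (at 0)" by simp
  moreover have "(\<lambda>t. f' (t *\<^sub>R v)) = (*) (f' v)"
    using der by (auto simp: has_derivative_def linear_cmul[OF bounded_linear.linear])
  ultimately have "((\<lambda>t. f (x + t *\<^sub>R v)) has_field_derivative f' v) (at 0)"
    by (simp add: has_field_derivative_def)
  then have smooth: "((\<lambda>t. (f (x + t *\<^sub>R v) - f x) / t) \<longlongrightarrow> f' v) (at_right 0)"
    by (auto simp: has_field_derivative_iff intro: tendsto_within_subset)
  define q where "q t = (phi (x + t *\<^sub>R v) - phi x) / t" for t
  \<comment> \<open>a monotone difference quotient bounded from below has a limit\<close>
  have "(q \<longlongrightarrow> Inf (q ` ({0<..} \<inter> UNIV))) (at 0 within ({0<..} \<inter> UNIV))"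
    by (rule Lim_right_bound[where K = "phi x - phi (x - v)"])
      (auto simp: q_def intro: convex_on_ray_slope_mono[OF cv] convex_on_ray_slope_lower_bound[OF cv])
  then have "(q \<longlongrightarrow> Inf (q ` {0<..})) (at_right 0)" by simp
  from tendsto_add[OF smooth this]
  have "((\<lambda>t. (psi (x + t *\<^sub>R v) - psi x) / t) \<longlongrightarrow> f' v + Inf (q ` {0<..})) (at_right 0)"
    by (simp add: psi_def q_def add_divide_distrib[symmetric] algebra_simps)
  with dir_deriv_eqI[OF this] show ?thesis by simp
qed

lemma dir_deriv_lipschitz_direction:
  fixes psi :: "'a::real_normed_vector \<Rightarrow> real"
  assumes lip: "L-lipschitz_on (cball x 1) psi" and "norm v \<le> 1" "norm w \<le> 1"
    and tv: "((\<lambda>t. (psi (x + t *\<^sub>R v) - psi x) / t) \<longlongrightarrow> dir_deriv psi x v) (at_right 0)"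
    and tw: "((\<lambda>t. (psi (x + t *\<^sub>R w) - psi x) / t) \<longlongrightarrow> dir_deriv psi x w) (at_right 0)"
  shows "\<bar>dir_deriv psi x v - dir_deriv psi x w\<bar> \<le> L * norm (v - w)"
proof (rule tendsto_upperbound[OF tendsto_rabs[OF tendsto_diff[OF tv tw]]])
  have "\<bar>(psi (x + t *\<^sub>R v) - psi x) / t - (psi (x + t *\<^sub>R w) - psi x) / t\<bar> \<le> L * norm (v - w)"
    if t: "0 < t" "t < 1" for t
  proof -
    have "x + t *\<^sub>R v \<in> cball x 1" "x + t *\<^sub>R w \<in> cball x 1"
      using t \<open>norm v \<le> 1\<close> \<open>norm w \<le> 1\<close> by (auto simp: dist_norm mult_le_one)
    from lipschitz_onD[OF lip this]
    have "\<bar>psi (x + t *\<^sub>R v) - psi (x + t *\<^sub>R w)\<bar> \<le> L * (t * norm (v - w))"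
      using t by (simp add: dist_real_def dist_norm scaleR_diff_right[symmetric])
    then show ?thesis
      using t by (simp add: diff_divide_distrib[symmetric] pos_divide_le_eq abs_divide mult_ac)
  qed
  then show "\<forall>\<^sub>F t in at_right 0. \<bar>(psi (x + t *\<^sub>R v) - psi x) / t - (psi (x + t *\<^sub>R w) - psi x) / t\<bar>
      \<le> L * norm (v - w)"
    using eventually_at_right_real[of 0 1] by (auto elim: eventually_mono)
qed simp

lemma quadratic_form_bound:
  fixes B :: "real^'n^'n"
  defines "C \<equiv> real CARD('n) * real CARD('n) * norm B"
  shows "\<bar>s \<bullet> (B *v s)\<bar> \<le> C * (norm s)\<^sup>2"
proof -
  have "onorm ((*v) B) \<le> C"
    unfolding C_def by (rule onorm_le_matrix_component)
      (meson Finite_Cartesian_Product.norm_nth_le component_le_norm_cart order_trans)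
  have "norm (B *v s) \<le> onorm ((*v) B) * norm s"
    by (rule onorm[OF matrix_vector_mul_bounded_linear])
  also have "\<dots> \<le> C * norm s" using \<open>onorm ((*v) B) \<le> C\<close> by (rule mult_right_mono) simp
  finally have "norm s * norm (B *v s) \<le> norm s * (C * norm s)" by (simp add: mult_left_mono)
  with Cauchy_Schwarz_ineq2[of s "B *v s"] show ?thesis by (simp add: power2_eq_square mult_ac)
qed

lemma real_of_ereal_min_ereal:
  assumes "0 < G" "0 < n"
  shows "0 < real_of_ereal (min G (ereal n))" "real_of_ereal (min G (ereal n)) \<le> n"
    and "ereal e \<le> G \<Longrightarrow> min e n \<le> real_of_ereal (min G (ereal n))"
  using assms by (cases G; auto simp: min_def)+

lemma subseq_tendsto_zero:
  fixes a :: "nat \<Rightarrow> real"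
  assumes frequently_small: "\<And>D K. 0 < D \<Longrightarrow> \<exists>k\<ge>K. a k < D \<and> P k" and nonneg: "\<And>k. 0 \<le> a k"
  obtains r where "strict_mono r" "(\<lambda>n. a (r n)) \<longlonglongrightarrow> 0" "\<And>n. P (r n)"
proof -
  define h where "h n K = (SOME k. K \<le> k \<and> a k < inverse (real (Suc n)) \<and> P k)" for n K
  have h: "K \<le> h n K \<and> a (h n K) < inverse (real (Suc n)) \<and> P (h n K)" for n K
    unfolding h_def by (rule someI_ex) (use frequently_small[of "inverse (real (Suc n))" K] in auto)
  define r where "r = rec_nat (h 0 0) (\<lambda>n rn. h (Suc n) (Suc rn))"
  have r0: "r 0 = h 0 0" and rSuc: "\<And>n. r (Suc n) = h (Suc n) (Suc (r n))"
    by (simp_all add: r_def)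
  have r: "a (r n) < inverse (real (Suc n)) \<and> P (r n)" for n
  proof (cases n)
    case 0
    then show ?thesis using h[where n = 0 and K = 0] by (simp add: r0)
  next
    case (Suc n')
    then show ?thesis using h[where n = n and K = "Suc (r n')"] by (simp add: rSuc)
  qed
  have "strict_mono r"
    by (rule strict_monoI_Suc) (metis rSuc h Suc_le_lessD)
  moreover have "(\<lambda>n. a (r n)) \<longlonglongrightarrow> 0"
    by (rule tendsto_sandwich[OF _ _ tendsto_const LIMSEQ_inverse_real_of_nat])
      (use nonneg r in \<open>auto intro: always_eventually less_imp_le\<close>)
  ultimately show thesis using r that by blast
qed

section \<open>The truncation loop\<close>

lemma can_truncate_antimono:
  assumes ct: "can_truncate Gam S m \<delta> \<kappa> T" and "i \<le> j" "j \<le> Suc m"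
  shows "S j \<subseteq> S i"
  using assms(2,3)
proof (induction j)
  case (Suc j)
  have "S (Suc j) \<subseteq> S j"
    using ct Suc.prems(2) by (cases "j < m") (auto simp: can_truncate_def not_less_less_Suc_eq)
  then show ?case
    using Suc by (cases "i = Suc j") auto
qed simp

lemma level_spec:
  assumes ct: "can_truncate Gam S m \<delta> \<kappa> T"
  shows "level S m y \<le> m \<and> y \<in> S (level S m y) \<and> y \<notin> S (Suc (level S m y))"
proof -
  define I where "I = {i. i \<le> m \<and> y \<in> S i}"
  define i where "i = Max I"
  have fin: "finite I" and "0 \<in> I" using ct by (auto simp: I_def can_truncate_def)
  then have "i \<in> I" using Max_in[OF fin] unfolding i_def by blast
  then have i: "i \<le> m" "y \<in> S i" by (simp_all add: I_def)
  have i_max: "\<And>j. j \<le> m \<Longrightarrow> y \<in> S j \<Longrightarrow> j \<le> i"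
    using Max_ge[OF fin] by (simp add: i_def I_def)
  have "y \<notin> S (Suc i)"
    using ct i i_max[of "Suc i"] by (cases "i = m") (auto simp: can_truncate_def)
  with i have "\<exists>i. i \<le> m \<and> y \<in> S i \<and> y \<notin> S (Suc i)" by blast
  then show ?thesis unfolding level_def by (rule someI_ex)
qed

lemma level_greatest:
  assumes ct: "can_truncate Gam S m \<delta> \<kappa> T" and "y \<in> S j" "j \<le> Suc m"
  shows "j \<le> level S m y"
proof (rule ccontr)
  assume "\<not> j \<le> level S m y"
  then have "S j \<subseteq> S (Suc (level S m y))" using can_truncate_antimono[OF ct _ assms(3)] by simp
  then show False using assms(2) level_spec[OF ct, of y] by auto
qed

lemma truncation_step:
  assumes ct: "can_truncate Gam S m \<delta> \<kappa> T" and "0 < a" "ereal a \<le> \<delta>" and "Gam y < ereal a"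
  shows "ereal a \<le> Gam (T y a)" "norm (T y a - y) \<le> \<kappa> * a" "level S m y < level S m (T y a)"
proof -
  note lv = level_spec[OF ct, of y]
  have "level S m y \<noteq> m"
  proof
    assume "level S m y = m"
    then have "\<delta> \<le> Gam y" using lv ct by (auto simp: can_truncate_def)
    then show False using assms(3,4) by simp
  qed
  with lv have "level S m y < m" by simp
  with assms(2,3) ct lv
  have "if ereal a \<le> Gam y then T y a = y
    else T y a \<in> S (Suc (level S m y)) \<and> ereal a \<le> Gam (T y a) \<and> norm (T y a - y) \<le> \<kappa> * a"
    unfolding can_truncate_def by blast
  moreover have "\<not> ereal a \<le> Gam y" using assms(4) by simp
  ultimately have T: "T y a \<in> S (Suc (level S m y))" "ereal a \<le> Gam (T y a)"
    "norm (T y a - y) \<le> \<kappa> * a"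
    by simp_all
  from T show "ereal a \<le> Gam (T y a)" "norm (T y a - y) \<le> \<kappa> * a" by simp_all
  show "level S m y < level S m (T y a)"
    using level_greatest[OF ct T(1)] \<open>level S m y < m\<close> by simp
qed

lemma trunc_loop_counters_mono:
  "trunc_loop Gam S m eps T y c y' c' \<Longrightarrow> c i \<le> c' i"
  by (induction rule: trunc_loop.induct) (auto split: if_splits)

lemma trunc_loop_stops:
  "trunc_loop Gam S m eps T y c y' c' \<Longrightarrow> \<not> Gam y' < ereal (eps (c' (level S m y')))"
  by (induction rule: trunc_loop.induct) auto

context
  fixes Gam :: "'a::real_normed_vector \<Rightarrow> ereal" and S m \<delta> \<kappa> T and eps :: "nat \<Rightarrow> real"
  assumes ct: "can_truncate Gam S m \<delta> \<kappa> T"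
    and eps: "\<And>i. 0 < eps i" "\<And>i. ereal (eps i) \<le> \<delta>"
begin

lemma trunc_loop_level_mono:
  "trunc_loop Gam S m eps T y c y' c' \<Longrightarrow> level S m y \<le> level S m y'"
  by (induction rule: trunc_loop.induct) (use truncation_step(3)[OF ct eps] in force)+

lemma trunc_loop_counter_changes_below_level:
  "trunc_loop Gam S m eps T y c y' c' \<Longrightarrow> c' j \<noteq> c j \<Longrightarrow> j < level S m y'"
proof (induction rule: trunc_loop.induct)
  case (step y c y' c')
  let ?i = "level S m y"
  have "?i < level S m y'"
    using truncation_step(3)[OF ct eps step.hyps(1)] trunc_loop_level_mono[OF step.hyps(2)] by simp
  then show ?case using step.IH step.prems by (cases "j = ?i") auto
qed simp

end

definition tail_sum :: "(nat \<Rightarrow> real) \<Rightarrow> nat \<Rightarrow> real" where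
  "tail_sum eps n = (\<Sum>j. eps (j + n))"

lemma tail_sum_Suc:
  assumes "summable eps"
  shows "tail_sum eps n = eps n + tail_sum eps (Suc n)"
  using suminf_split_head[OF summable_ignore_initial_segment[OF assms, of n]]
  by (simp add: tail_sum_def)

lemma tail_sum_nonneg:
  assumes "summable eps" "\<And>i. 0 \<le> eps i"
  shows "0 \<le> tail_sum eps n"
  unfolding tail_sum_def
  using assms summable_ignore_initial_segment[OF assms(1), of n] by (intro suminf_nonneg) auto

lemma sum_comp_fun_upd:
  fixes h :: "'a \<Rightarrow> 'b::ab_group_add"
  assumes "finite A" "i \<in> A"
  shows "(\<Sum>j\<in>A. h ((c(i := v)) j)) = (\<Sum>j\<in>A. h (c j)) - h (c i) + h v"
proof -
  have "(\<Sum>j\<in>A - {i}. h ((c(i := v)) j)) = (\<Sum>j\<in>A - {i}. h (c j))"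
    by (rule sum.cong) auto
  with assms have "(\<Sum>j\<in>A. h ((c(i := v)) j)) = h v + (\<Sum>j\<in>A - {i}. h (c j))"
    by (simp add: sum.remove)
  moreover have "(\<Sum>j\<in>A. h (c j)) = h (c i) + (\<Sum>j\<in>A - {i}. h (c j))"
    using assms by (simp add: sum.remove)
  ultimately show ?thesis by simp
qed

text \<open>Each pass of the truncation loop moves the point by at most \<open>\<kappa> a\<close>, which costs at most
  \<open>L \<kappa> a\<close> in \<open>psi\<close>; this is paid for by the tail sum of the incremented counter, which drops by
  exactly \<open>a\<close>. The norm bound is kept because every pass raises the level.\<close>

lemma trunc_loop_merit_decrease:
  assumes ct: "can_truncate Gam S m \<delta> \<kappa> T"
    and eps: "\<And>i. 0 < eps i" "\<And>i. ereal (eps i) \<le> \<delta>" "summable eps" "\<And>i. eps i \<le> E"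
    and lip: "L-lipschitz_on (cball 0 (r + real m * \<kappa> * E)) psi"
  shows "trunc_loop Gam S m eps T y c y' c' \<Longrightarrow> norm y \<le> r + real (level S m y) * \<kappa> * E \<Longrightarrow>
    psi y' + L * \<kappa> * (\<Sum>i\<le>m. tail_sum eps (c' i)) \<le> psi y + L * \<kappa> * (\<Sum>i\<le>m. tail_sum eps (c i))"
proof (induction rule: trunc_loop.induct)
  case (step y c y' c')
  define i where "i = level S m y"
  define a where "a = eps (c i)"
  define y1 where "y1 = T y a"
  have \<kappa>: "0 < \<kappa>" using ct by (simp add: can_truncate_def)
  have a: "0 < a" "a \<le> E" using eps by (auto simp: a_def)
  note tr = truncation_step[OF ct eps(1,2) step.hyps(1), folded i_def a_def, folded y1_def]
  have "norm y1 \<le> norm y + \<kappa> * a"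
    using tr(2) norm_triangle_ineq2[of y1 y] by simp
  also have "\<dots> \<le> r + real (Suc i) * \<kappa> * E"
  proof -
    have "\<kappa> * a \<le> \<kappa> * E" using a \<kappa> by simp
    then show ?thesis using step.prems by (simp add: i_def algebra_simps)
  qed
  also have "\<dots> \<le> r + real (level S m y1) * \<kappa> * E"
    using tr(3) a \<kappa> by (intro add_left_mono mult_right_mono) auto
  finally have y1: "norm y1 \<le> r + real (level S m y1) * \<kappa> * E" .
  have in_ball: "z \<in> cball 0 (r + real m * \<kappa> * E)"
    if "norm z \<le> r + real (level S m z) * \<kappa> * E" for z
    using that level_spec[OF ct, of z] \<kappa> a by (auto intro: order_trans mult_right_mono)
  have "\<bar>psi y1 - psi y\<bar> \<le> L * norm (y1 - y)"
    using lipschitz_onD[OF lip in_ball[OF y1] in_ball[OF step.prems]] by (simp add: dist_real_def dist_norm)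
  also have "\<dots> \<le> L * (\<kappa> * a)" using tr(2) lipschitz_on_nonneg[OF lip] by (rule mult_left_mono)
  finally have "psi y1 \<le> psi y + L * (\<kappa> * a)" by linarith
  moreover have "(\<Sum>j\<le>m. tail_sum eps ((c(i := Suc (c i))) j)) = (\<Sum>j\<le>m. tail_sum eps (c j)) - a"
    using sum_comp_fun_upd[of "{..m}" i "tail_sum eps" c] level_spec[OF ct, of y]
      tail_sum_Suc[OF eps(3), of "c i"]
    by (simp add: a_def i_def)
  then have "L * \<kappa> * (\<Sum>j\<le>m. tail_sum eps ((c(i := Suc (c i))) j))
      = L * \<kappa> * (\<Sum>j\<le>m. tail_sum eps (c j)) - L * \<kappa> * a"
    by (simp add: right_diff_distrib)
  ultimately show ?case
    using step.IH[folded i_def a_def y1_def, OF y1] by (simp add: mult.assoc)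
qed simp

section \<open>Convergence of the algorithm\<close>

locale trust_region_run =
  fixes f phi psi :: "real^'n \<Rightarrow> real" and gradf :: "real^'n \<Rightarrow> real^'n"
    and u :: "real^'n \<Rightarrow> real" and d :: "real^'n \<Rightarrow> real^'n"
    and Gs :: "real^'n \<Rightarrow> real^'n \<Rightarrow> ereal"
    and S :: "nat \<Rightarrow> (real^'n) set" and m :: nat and \<delta> :: ereal and \<kappa> :: real
    and T :: "real^'n \<Rightarrow> real \<Rightarrow> real^'n"
    and \<eta> \<eta>1 \<eta>2 r1 r2 \<Delta>max \<gamma>1 \<gamma>2 :: real
    and \<epsilon> :: "nat \<Rightarrow> real" and ell :: "real \<Rightarrow> real"
    and x :: "nat \<Rightarrow> real^'n" and \<Delta> :: "nat \<Rightarrow> real" and c :: "nat \<Rightarrow> nat \<Rightarrow> nat"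
    and B :: "nat \<Rightarrow> real^'n^'n"
    and g sC s sf xt :: "nat \<Rightarrow> real^'n"
    and aC \<alpha>0 \<alpha> \<rho>1 \<rho>2 :: "nat \<Rightarrow> real"
    and R \<kappa>B :: real
  assumes f_C1: "\<forall>y. (f has_derivative (\<lambda>h. gradf y \<bullet> h)) (at y)" "continuous_on UNIV gradf"
    and phi_convex: "convex_on UNIV phi"
    and psi_def: "psi = (\<lambda>y. f y + phi y)"
    and pg_nonstat: "\<forall>y. \<not> stationary gradf phi y \<longrightarrow>
          norm (d y) = 1 \<and> dir_deriv psi y (d y) < 0 \<and> dir_deriv psi y (d y) \<le> u y \<and> u y < 0"
    and pg_stat: "\<forall>y. stationary gradf phi y \<longrightarrow> d y = 0 \<and> u y = 0"
    and Gs_pos: "\<forall>y e. norm e = 1 \<longrightarrow> 0 < Gs y e"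
    and trunc: "can_truncate (Gamma_pt psi) S m \<delta> \<kappa> T"
    and params: "0 < \<eta>" "\<eta> < \<eta>1" "\<eta>1 < \<eta>2" "\<eta>2 < 1" "0 < r1" "r1 < 1" "1 < r2"
       "0 < \<Delta>max" "0 < \<gamma>1" "0 < \<gamma>2"
    and eps_seq: "\<forall>i. 0 < \<epsilon> i" "\<forall>i. \<epsilon> (Suc i) < \<epsilon> i" "summable \<epsilon>" "\<forall>i. ereal (\<epsilon> i) \<le> \<delta>"
    and ell_ass: "\<forall>t>0. 0 \<le> ell t \<and> ell t \<le> 1/2" "\<forall>a b. 0 < a \<longrightarrow> a \<le> b \<longrightarrow> ell b \<le> ell a"
       "(ell \<longlongrightarrow> 0) (at_right 0)"
    and init: "0 < \<Delta> 0"
    and g_def: "\<forall>k. g k = u (x k) *\<^sub>R d (x k)"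
    and nonterm: "\<forall>k. g k \<noteq> 0"
    and cauchy: "\<forall>k. 0 \<le> aC k \<and> aC k \<le> \<Delta> k / norm (g k) \<and>
          (\<forall>t. 0 \<le> t \<and> t \<le> \<Delta> k / norm (g k) \<longrightarrow>
             tr_model (psi (x k)) (g k) (B k) (- (aC k *\<^sub>R g k))
               \<le> tr_model (psi (x k)) (g k) (B k) (- (t *\<^sub>R g k)))"
    and sC_def: "\<forall>k. sC k = - (aC k *\<^sub>R g k)"
    and step: "\<forall>k. norm (s k) \<le> \<Delta> k \<and>
          tr_model (psi (x k)) (g k) (B k) 0 - tr_model (psi (x k)) (g k) (B k) (s k)
            \<ge> \<gamma>1 / 2 * norm (g k) * min (\<Delta> k) (\<gamma>2 * norm (g k)) \<and>
          tr_model (psi (x k)) (g k) (B k) 0 - tr_model (psi (x k)) (g k) (B k) (s k)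
            \<ge> (1 - ell (norm (s k))) *
              (tr_model (psi (x k)) (g k) (B k) 0 - tr_model (psi (x k)) (g k) (B k) (sC k))"
    and rho1_def: "\<forall>k. \<rho>1 k = (psi (x k) - psi (x k + s k)) /
          (tr_model (psi (x k)) (g k) (B k) 0 - tr_model (psi (x k)) (g k) (B k) (s k))"
    and alpha0_def: "\<forall>k. \<alpha>0 k = real_of_ereal (min (Gs (x k) (sgn (s k))) (ereal (norm (s k))))"
    and sf_def: "\<forall>k. sf k = (if tr_model (psi (x k)) (g k) (B k) 0
                                 - tr_model (psi (x k)) (g k) (B k) (\<alpha>0 k *\<^sub>R sgn (s k))
                               < \<alpha>0 k / (2 * norm (s k)) *
                                 (tr_model (psi (x k)) (g k) (B k) 0
                                   - tr_model (psi (x k)) (g k) (B k) (s k))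
                            then sC k else s k)"
    and alpha_def: "\<forall>k. \<alpha> k = real_of_ereal (min (Gs (x k) (sgn (sf k))) (ereal (norm (sf k))))"
    and rho2_def: "\<forall>k. \<rho>2 k = (psi (x k) - psi (x k + \<alpha> k *\<^sub>R sgn (sf k))) /
          (tr_model (psi (x k)) (g k) (B k) 0
            - tr_model (psi (x k)) (g k) (B k) (\<alpha> k *\<^sub>R sgn (sf k)))"
    and upd_succ: "\<forall>k. \<rho>1 k \<ge> \<eta>1 \<longrightarrow> xt k = x k + s k \<and>
          \<Delta> (Suc k) = (if \<rho>1 k > \<eta>2 then min \<Delta>max (r2 * \<Delta> k) else \<Delta> k)"
    and upd_fail: "\<forall>k. \<rho>1 k < \<eta>1 \<longrightarrow>
          \<Delta> (Suc k) = (if \<rho>2 k < \<eta>1 then r1 * \<Delta> k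
                        else if \<rho>2 k > \<eta>2 then min \<Delta>max (r2 * \<Delta> k) else \<Delta> k) \<and>
          xt k = (if \<rho>2 k \<ge> \<eta> then x k + \<alpha> k *\<^sub>R sgn (sf k) else x k)"
    and trunc_step: "\<forall>k. trunc_loop (Gamma_pt psi) S m \<epsilon> T (xt k) (c k) (x (Suc k)) (c (Suc k))"
    and A1: "bdd_below (range psi)"
    and B1: "\<forall>k. x k \<in> ball 0 R"
    and B2: "0 < \<kappa>B" "\<forall>k. norm (B k) \<le> \<kappa>B"
    and B3: "\<forall>r::nat \<Rightarrow> nat. strict_mono r \<and> convergent (\<lambda>l. x (r l)) \<and> (\<lambda>l. \<alpha> (r l)) \<longlonglongrightarrow> 0 \<longrightarrow>
          (\<lambda>l. psi (x (r l) + \<alpha> (r l) *\<^sub>R sgn (sf (r l))) - psi (x (r l))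
                 - \<alpha> (r l) * dir_deriv psi (x (r l)) (sgn (sf (r l))))
            \<in> o(\<lambda>l. \<alpha> (r l))"
    and B4: "\<forall>e>0. \<exists>e'>0. \<forall>k. ereal e \<le> Gamma_pt psi (x k) \<longrightarrow> ereal e' \<le> Gs (x k) (sgn (sf k))"
begin

text \<open>The predicted reduction \<open>m\<^sub>k(0) - m\<^sub>k(w)\<close> of the paper.\<close>

abbreviation pred :: "nat \<Rightarrow> real^'n \<Rightarrow> real" where
  "pred k w \<equiv> tr_model (psi (x k)) (g k) (B k) 0 - tr_model (psi (x k)) (g k) (B k) w"

text \<open>As \<open>ell\<close> is nonincreasing, nonnegative and tends to \<open>0\<close> at \<open>0\<^sup>+\<close>, it vanishes on \<open>(0,\<infinity>)\<close>:
  the second descent condition on the trial step is then a comparison with the Cauchy point.\<close>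

lemma ell_vanishes: "0 < t \<Longrightarrow> ell t = 0"
proof -
  assume t: "0 < t"
  have "\<forall>\<^sub>F a in at_right 0. ell t \<le> ell a"
    using eventually_at_right_real[OF t] ell_ass(2) by (auto elim!: eventually_mono)
  then have "ell t \<le> 0" by (rule tendsto_lowerbound[OF ell_ass(3)]) simp
  with ell_ass(1) t show ?thesis by force
qed

definition \<Delta>ub :: real where "\<Delta>ub = max (\<Delta> 0) \<Delta>max"

lemma Delta_pos_le: "0 < \<Delta> k \<and> \<Delta> k \<le> \<Delta>ub"
proof (induction k)
  case 0 then show ?case using init by (simp add: \<Delta>ub_def)
next
  case (Suc k)
  have "r1 * \<Delta> k \<le> \<Delta> k" using Suc params by (simp add: mult_le_cancel_right1)
  then have "\<Delta>max \<le> \<Delta>ub" "r1 * \<Delta> k \<le> \<Delta>ub" using Suc by (simp add: \<Delta>ub_def, linarith)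
  then show ?case
    using upd_succ[rule_format, of k] upd_fail[rule_format, of k] Suc params
    by (cases "\<rho>1 k \<ge> \<eta>1") (auto simp: min_def)
qed

lemma Delta_pos: "0 < \<Delta> k" and Delta_le: "\<Delta> k \<le> \<Delta>ub"
  using Delta_pos_le by simp_all

lemma iterate_not_stationary: "\<not> stationary gradf phi (x k)"
  using pg_stat g_def nonterm by auto

lemma g_norm_pos: "0 < norm (g k)"
  using nonterm by simp

lemma d_unit: "norm (d (x k)) = 1"
  using pg_nonstat iterate_not_stationary by blast

lemma g_eq: "g k = - norm (g k) *\<^sub>R d (x k)"
  using pg_nonstat iterate_not_stationary[of k] g_def by (auto simp: abs_if)

lemma dir_deriv_d_le: "dir_deriv psi (x k) (d (x k)) \<le> - norm (g k)"
  using pg_nonstat iterate_not_stationary[of k] g_def by auto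

lemma norm_iterate_le: "norm (x k) \<le> R"
  using B1 by (simp add: less_imp_le)

text \<open>A ball containing the iterates, the trial points and every point visited by the truncation
  loop (see \<open>trunc_loop_merit_decrease\<close>).\<close>

definition Rlip :: real where "Rlip = R + \<Delta>ub + real m * \<kappa> * \<epsilon> 0 + 1"

lemma kappa_pos: "0 < \<kappa>"
  using trunc by (simp add: can_truncate_def)

lemma Rlip_ge: "R + \<Delta>ub + real m * \<kappa> * \<epsilon> 0 \<le> Rlip" "R + 1 \<le> Rlip"
proof -
  have "0 \<le> real m * \<kappa> * \<epsilon> 0" using kappa_pos eps_seq(1) by (simp add: less_imp_le)
  then show "R + \<Delta>ub + real m * \<kappa> * \<epsilon> 0 \<le> Rlip" "R + 1 \<le> Rlip"
    using Delta_pos[of 0] Delta_le[of 0] by (simp_all add: Rlip_def)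
qed

definition Lpsi :: real where
  "Lpsi = (SOME L. 0 < L \<and> L-lipschitz_on (cball 0 Rlip) psi)"

lemma Lpsi: "0 < Lpsi" "Lpsi-lipschitz_on (cball 0 Rlip) psi"
proof -
  obtain L1 where "L1-lipschitz_on (cball 0 Rlip) f"
    using gradient_lipschitz_on_compact_convex[OF f_C1(1)[rule_format] f_C1(2) compact_cball convex_cball]
    by blast
  moreover obtain L2 where "L2-lipschitz_on (cball 0 Rlip) phi"
    using convex_on_lipschitz_on_cball[OF phi_convex] by blast
  ultimately have "(L1 + L2)-lipschitz_on (cball 0 Rlip) psi"
    unfolding psi_def by (rule lipschitz_on_add)
  then have "\<exists>L. 0 < L \<and> L-lipschitz_on (cball 0 Rlip) psi"
    by (intro exI[of _ "L1 + L2 + 1"]) (auto intro: lipschitz_on_le dest: lipschitz_on_nonneg)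
  then have "0 < Lpsi \<and> Lpsi-lipschitz_on (cball 0 Rlip) psi"
    unfolding Lpsi_def by (rule someI_ex)
  then show "0 < Lpsi" "Lpsi-lipschitz_on (cball 0 Rlip) psi" by simp_all
qed

lemma dir_deriv_psi_tendsto:
  "((\<lambda>t. (psi (y + t *\<^sub>R v) - psi y) / t) \<longlongrightarrow> dir_deriv psi y v) (at_right 0)"
  using dir_deriv_smooth_plus_convex[OF f_C1(1)[rule_format] phi_convex] by (simp add: psi_def)

lemma dir_deriv_psi_lipschitz:
  assumes "norm y \<le> R" "norm v \<le> 1" "norm w \<le> 1"
  shows "\<bar>dir_deriv psi y v - dir_deriv psi y w\<bar> \<le> Lpsi * norm (v - w)"
proof (rule dir_deriv_lipschitz_direction[OF _ assms(2,3) dir_deriv_psi_tendsto dir_deriv_psi_tendsto])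
  have "cball y 1 \<subseteq> cball 0 Rlip"
  proof
    fix z assume "z \<in> cball y 1"
    then have "norm (z - y) \<le> 1" by (simp add: dist_norm norm_minus_commute)
    then show "z \<in> cball 0 Rlip" using norm_triangle_sub[of z y] assms(1) Rlip_ge(2) by simp
  qed
  then show "Lpsi-lipschitz_on (cball y 1) psi"
    using Lpsi(2) by (rule lipschitz_on_subset[rotated])
qed

lemma g_norm_le: "norm (g k) \<le> Lpsi"
proof -
  have "\<bar>dir_deriv psi (x k) (d (x k)) - dir_deriv psi (x k) 0\<bar> \<le> Lpsi"
    using dir_deriv_psi_lipschitz[OF norm_iterate_le, of "d (x k)" 0] d_unit by simp
  then show ?thesis
    using dir_deriv_d_le[of k] by (simp add: dir_deriv_zero_direction)
qed

definition \<kappa>q :: real where "\<kappa>q = real CARD('n) * real CARD('n) * \<kappa>B"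

lemma kappa_q_pos: "0 < \<kappa>q"
  using B2 by (simp add: \<kappa>q_def)

lemma quadratic_term_le: "\<bar>w \<bullet> (B k *v w)\<bar> \<le> \<kappa>q * (norm w)\<^sup>2"
proof -
  have "real CARD('n) * real CARD('n) * norm (B k) * (norm w)\<^sup>2 \<le> \<kappa>q * (norm w)\<^sup>2"
    unfolding \<kappa>q_def using B2(2) by (intro mult_right_mono mult_left_mono) auto
  with quadratic_form_bound[of w "B k"] show ?thesis by linarith
qed

lemma pred_eq: "pred k w = - (g k \<bullet> w) - 1/2 * (w \<bullet> (B k *v w))"
  by (simp add: tr_model_def)

lemma pred_le: "pred k w \<le> Lpsi * norm w + \<kappa>q / 2 * (norm w)\<^sup>2"
proof -
  have "- (g k \<bullet> w) \<le> norm (g k) * norm w"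
    using Cauchy_Schwarz_ineq2[of "g k" w] by linarith
  also have "\<dots> \<le> Lpsi * norm w" using g_norm_le[of k] by (simp add: mult_right_mono)
  finally show ?thesis using quadratic_term_le[of w k] by (simp add: pred_eq)
qed

lemma norm_ge_if_pred_ge:
  assumes "\<theta> \<le> pred k w" "0 < \<theta>"
  shows "min 1 (\<theta> / (Lpsi + \<kappa>q)) \<le> norm w"
proof (rule ccontr)
  assume "\<not> ?thesis"
  then have "norm w < 1" "norm w < \<theta> / (Lpsi + \<kappa>q)" by auto
  then have w: "norm w < 1" "norm w * (Lpsi + \<kappa>q) < \<theta>"
    using Lpsi(1) kappa_q_pos by (simp_all add: pos_less_divide_eq)
  have "(norm w)\<^sup>2 \<le> norm w" using w(1) by (simp add: power2_eq_square mult_left_le_one_le)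
  then have "(norm w)\<^sup>2 \<le> 2 * norm w" using norm_ge_zero[of w] by linarith
  then have "\<kappa>q / 2 * (norm w)\<^sup>2 \<le> \<kappa>q / 2 * (2 * norm w)"
    using kappa_q_pos by (intro mult_left_mono) auto
  then have "pred k w \<le> (Lpsi + \<kappa>q) * norm w"
    using pred_le[of k w] by (simp add: distrib_right)
  with w assms show False by (simp add: mult.commute)
qed

lemma pred_along_d:
  "pred k (t *\<^sub>R d (x k)) = t * norm (g k) - t\<^sup>2 / 2 * (d (x k) \<bullet> (B k *v d (x k)))"
proof -
  have "g k \<bullet> d (x k) = - norm (g k)"
    by (subst g_eq) (simp add: d_unit inner_scaleR_left flip: power2_norm_eq_inner)
  then show ?thesis by (simp add: pred_eq matrix_vector_mult_scaleR power2_eq_square)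
qed

lemma curvature_along_d_le: "d (x k) \<bullet> (B k *v d (x k)) \<le> \<kappa>q"
  using quadratic_term_le[of "d (x k)" k] d_unit[of k] by simp

lemma cauchy_point_optimal:
  assumes "0 \<le> t" "t \<le> \<Delta> k"
  shows "pred k (t *\<^sub>R d (x k)) \<le> pred k (sC k)"
proof -
  have "- ((t / norm (g k)) *\<^sub>R g k) = t *\<^sub>R d (x k)"
    using g_norm_pos[of k] by (subst (2) g_eq) simp
  moreover have "0 \<le> t / norm (g k)" "t / norm (g k) \<le> \<Delta> k / norm (g k)"
    using assms g_norm_pos[of k] by (simp_all add: divide_right_mono)
  then have "tr_model (psi (x k)) (g k) (B k) (- (aC k *\<^sub>R g k))
      \<le> tr_model (psi (x k)) (g k) (B k) (- ((t / norm (g k)) *\<^sub>R g k))"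
    using cauchy by blast
  ultimately show ?thesis using sC_def by simp
qed

lemma cauchy_decrease_ge:
  assumes "0 \<le> t" "t \<le> \<Delta> k"
  shows "t * norm (g k) - \<kappa>q * t\<^sup>2 / 2 \<le> pred k (sC k)"
proof -
  have "t\<^sup>2 / 2 * (d (x k) \<bullet> (B k *v d (x k))) \<le> t\<^sup>2 / 2 * \<kappa>q"
    using curvature_along_d_le by (intro mult_left_mono) auto
  then show ?thesis
    using cauchy_point_optimal[OF assms] pred_along_d[of k t] by (simp add: mult.commute)
qed

lemma cauchy_step_size_pos: "0 < aC k"
proof -
  define t where "t = min (\<Delta> k) (norm (g k) / \<kappa>q)"
  have t: "0 < t" "t \<le> \<Delta> k" "t * \<kappa>q \<le> norm (g k)"
    using Delta_pos[of k] g_norm_pos[of k] kappa_q_pos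
    by (auto simp: t_def min_def pos_le_divide_eq field_simps)
  have "\<kappa>q * t\<^sup>2 / 2 \<le> t * norm (g k) / 2"
    using mult_left_mono[OF t(3), of t] t(1) by (simp add: power2_eq_square algebra_simps)
  moreover have "0 < t * norm (g k) / 2" using t(1) g_norm_pos[of k] by simp
  ultimately have "0 < pred k (sC k)"
    using cauchy_decrease_ge[of t k] t(1,2) by linarith
  moreover have "0 \<le> aC k" using cauchy by blast
  ultimately show ?thesis
    using sC_def by (cases "aC k = 0") (auto simp: pred_eq)
qed

lemma cauchy_point_eq: "sC k = norm (sC k) *\<^sub>R d (x k)"
  and norm_cauchy_point_pos: "0 < norm (sC k)"
  and norm_cauchy_point_le: "norm (sC k) \<le> \<Delta> k"
proof -
  define G where "G = norm (g k)"
  have "g k = - G *\<^sub>R d (x k)" using g_eq[of k] by (simp add: G_def)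
  then have "sC k = (aC k * G) *\<^sub>R d (x k)" using sC_def by simp
  then have "sC k = (aC k * norm (g k)) *\<^sub>R d (x k)" by (simp add: G_def)
  moreover have a: "0 < aC k * norm (g k)"
    using cauchy_step_size_pos[of k] g_norm_pos[of k] by simp
  ultimately show "sC k = norm (sC k) *\<^sub>R d (x k)" "0 < norm (sC k)"
    using d_unit[of k] by simp_all
  have "aC k \<le> \<Delta> k / norm (g k)" using cauchy by blast
  then have "aC k * norm (g k) \<le> \<Delta> k" using g_norm_pos[of k] by (simp add: pos_le_divide_eq)
  then show "norm (sC k) \<le> \<Delta> k" using sC_def cauchy_step_size_pos[of k] by simp
qed

lemma sgn_cauchy_point: "sgn (sC k) = d (x k)"
proof -
  have "sgn (sC k) = sgn (norm (sC k)) *\<^sub>R sgn (d (x k))"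
    by (subst cauchy_point_eq) (rule sgn_scaleR)
  then show ?thesis using norm_cauchy_point_pos[of k] d_unit[of k] by (simp add: sgn_div_norm)
qed

text \<open>If the curvature \<open>b\<close> of the model along \<open>d\<close> is positive, optimality of the Cauchy point
  forces \<open>norm (sC k) * b \<le> norm (g k)\<close>.\<close>

lemma cauchy_decrease_linear:
  assumes "0 < a" "a \<le> norm (sC k)"
  shows "a * norm (g k) / 2 \<le> pred k (a *\<^sub>R d (x k))"
proof -
  define b where "b = d (x k) \<bullet> (B k *v d (x k))"
  define G where "G = norm (g k)"
  define \<tau> where "\<tau> = norm (sC k)"
  have q: "pred k (t *\<^sub>R d (x k)) = t * G - t\<^sup>2 / 2 * b" for t
    by (simp add: pred_along_d G_def b_def)
  have "\<tau> * b \<le> G" if b: "0 < b"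
  proof (cases "G / b \<le> \<Delta> k")
    case True
    have "pred k ((G / b) *\<^sub>R d (x k)) \<le> pred k (\<tau> *\<^sub>R d (x k))"
      using cauchy_point_optimal[OF _ True] cauchy_point_eq[of k] b g_norm_pos[of k]
      by (simp add: \<tau>_def G_def)
    moreover have "b / 2 * (\<tau> - G / b)\<^sup>2
        = pred k ((G / b) *\<^sub>R d (x k)) - pred k (\<tau> *\<^sub>R d (x k))"
      unfolding q using b by (simp add: power2_eq_square field_simps)
    ultimately have "b / 2 * (\<tau> - G / b)\<^sup>2 \<le> 0" by simp
    then have "\<tau> = G / b" using b by (simp add: mult_le_0_iff)
    then show ?thesis using b by simp
  next
    case False
    then have "\<tau> < G / b" using norm_cauchy_point_le[of k] by (simp add: \<tau>_def)
    then show ?thesis using b by (simp add: pos_less_divide_eq)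
  qed
  then have "a * b \<le> G"
  proof (cases "0 < b")
    case True
    then have "a * b \<le> \<tau> * b" using assms(2) by (simp add: \<tau>_def)
    with \<open>0 < b \<Longrightarrow> \<tau> * b \<le> G\<close>[OF True] show ?thesis by linarith
  next
    case False
    then have "a * b \<le> 0" using assms(1) by (simp add: mult_nonneg_nonpos)
    then show ?thesis using g_norm_pos[of k] unfolding G_def by linarith
  qed
  then have "a\<^sup>2 / 2 * b \<le> a * G / 2"
    using assms(1) by (simp add: power2_eq_square mult_left_mono mult.assoc)
  then show ?thesis using q[of a] by (simp add: G_def)
qed

lemma trial_decrease_ge: "\<gamma>1 / 2 * norm (g k) * min (\<Delta> k) (\<gamma>2 * norm (g k)) \<le> pred k (s k)"
  using step by blast

lemma trial_decrease_pos: "0 < pred k (s k)"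
proof -
  have "0 < \<gamma>1 / 2 * norm (g k) * min (\<Delta> k) (\<gamma>2 * norm (g k))"
    using params g_norm_pos Delta_pos by simp
  with trial_decrease_ge[of k] show ?thesis by linarith
qed

lemma trial_step_nonzero: "s k \<noteq> 0"
  using trial_decrease_pos[of k] by (auto simp: pred_eq)

lemma norm_trial_step_le: "norm (s k) \<le> \<Delta> k"
  using step by blast

lemma trial_decrease_ge_cauchy: "pred k (sC k) \<le> pred k (s k)"
  using step[rule_format, of k] ell_vanishes trial_step_nonzero[of k] by simp

lemma final_step_cases:
  "sf k = sC k \<or> sf k = s k \<and> \<alpha> k / (2 * norm (s k)) * pred k (s k) \<le> pred k (\<alpha> k *\<^sub>R sgn (sf k))"
proof (cases "sf k = sC k")
  case False
  then have "sf k = s k"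
    and "\<not> pred k (\<alpha>0 k *\<^sub>R sgn (s k)) < \<alpha>0 k / (2 * norm (s k)) * pred k (s k)"
    using sf_def[rule_format, of k] by (auto split: if_splits)
  moreover have "\<alpha> k = \<alpha>0 k" using alpha_def alpha0_def \<open>sf k = s k\<close> by simp
  ultimately show ?thesis by simp
qed simp

lemma final_step_nonzero: "sf k \<noteq> 0"
  and norm_final_step_le: "norm (sf k) \<le> \<Delta> k"
  using final_step_cases[of k] trial_step_nonzero[of k] norm_cauchy_point_pos[of k]
    norm_trial_step_le[of k] norm_cauchy_point_le[of k]
  by auto

lemma norm_sgn_final_step: "norm (sgn (sf k)) = 1"
  using final_step_nonzero[of k] by (simp add: norm_sgn)

lemma stepsize_pos: "0 < \<alpha> k"
  and stepsize_le: "\<alpha> k \<le> norm (sf k)"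
  and stepsize_ge: "ereal e \<le> Gs (x k) (sgn (sf k)) \<Longrightarrow> min e (norm (sf k)) \<le> \<alpha> k"
  using real_of_ereal_min_ereal[of "Gs (x k) (sgn (sf k))" "norm (sf k)"]
    Gs_pos norm_sgn_final_step[of k] final_step_nonzero[of k] alpha_def
  by auto

lemma stepsize_decrease_ge:
  "min (\<alpha> k * norm (g k) / 2) (\<alpha> k / (2 * norm (s k)) * pred k (s k))
    \<le> pred k (\<alpha> k *\<^sub>R sgn (sf k))"
proof (cases "sf k = sC k")
  case True
  then show ?thesis
    using cauchy_decrease_linear[OF stepsize_pos, of k] stepsize_le[of k] sgn_cauchy_point[of k]
    by (simp add: min.coboundedI1)
next
  case False
  then have "\<alpha> k / (2 * norm (s k)) * pred k (s k) \<le> pred k (\<alpha> k *\<^sub>R sgn (sf k))"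
    using final_step_cases[of k] by blast
  then show ?thesis by (rule min.coboundedI2)
qed

lemma stepsize_decrease_ge_linear:
  assumes "\<theta> \<le> pred k (s k)" "0 \<le> \<theta>"
  shows "\<alpha> k * min (norm (g k) / 2) (\<theta> / (2 * \<Delta> k)) \<le> pred k (\<alpha> k *\<^sub>R sgn (sf k))"
proof -
  have a: "0 < \<alpha> k" and s: "0 < norm (s k)" "norm (s k) \<le> \<Delta> k"
    using stepsize_pos trial_step_nonzero norm_trial_step_le by auto
  have "\<alpha> k * (\<theta> / (2 * \<Delta> k)) \<le> \<alpha> k / (2 * norm (s k)) * \<theta>"
    using a s assms(2) by (simp add: frac_le mult_left_mono)
  also have "\<dots> \<le> \<alpha> k / (2 * norm (s k)) * pred k (s k)"
    using a s assms(1) by (intro mult_left_mono) auto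
  finally have "\<alpha> k * min (norm (g k) / 2) (\<theta> / (2 * \<Delta> k))
      \<le> min (\<alpha> k * norm (g k) / 2) (\<alpha> k / (2 * norm (s k)) * pred k (s k))"
    using a by (auto simp: min_mult_distrib_left intro: min.mono)
  with stepsize_decrease_ge[of k] show ?thesis by linarith
qed

lemma stepsize_decrease_pos: "0 < pred k (\<alpha> k *\<^sub>R sgn (sf k))"
proof -
  have "0 < \<alpha> k * norm (g k) / 2" "0 < \<alpha> k / (2 * norm (s k)) * pred k (s k)"
    using stepsize_pos[of k] g_norm_pos[of k] trial_step_nonzero[of k] trial_decrease_pos[of k]
    by simp_all
  then show ?thesis using stepsize_decrease_ge[of k] by linarith
qed

definition ared :: "nat \<Rightarrow> real" where "ared k = psi (x k) - psi (xt k)"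

lemma successful_iteration:
  assumes "\<eta>1 \<le> \<rho>1 k"
  shows "xt k = x k + s k" "\<eta>1 * pred k (s k) \<le> ared k"
proof -
  show xt: "xt k = x k + s k" using upd_succ assms by blast
  have "\<eta>1 \<le> (psi (x k) - psi (x k + s k)) / pred k (s k)" using assms rho1_def by simp
  then show "\<eta>1 * pred k (s k) \<le> ared k"
    using trial_decrease_pos[of k] by (simp add: pos_le_divide_eq ared_def xt)
qed

lemma accepted_iteration:
  assumes "\<rho>1 k < \<eta>1" "\<eta> \<le> \<rho>2 k"
  shows "xt k = x k + \<alpha> k *\<^sub>R sgn (sf k)" "\<eta> * pred k (\<alpha> k *\<^sub>R sgn (sf k)) \<le> ared k"
proof -
  show xt: "xt k = x k + \<alpha> k *\<^sub>R sgn (sf k)" using upd_fail assms by auto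
  have "\<eta> \<le> (psi (x k) - psi (x k + \<alpha> k *\<^sub>R sgn (sf k))) / pred k (\<alpha> k *\<^sub>R sgn (sf k))"
    using assms rho2_def by simp
  then show "\<eta> * pred k (\<alpha> k *\<^sub>R sgn (sf k)) \<le> ared k"
    using stepsize_decrease_pos[of k] by (simp add: pos_le_divide_eq ared_def xt)
qed

lemma rejected_iteration: "\<rho>1 k < \<eta>1 \<Longrightarrow> \<rho>2 k < \<eta> \<Longrightarrow> xt k = x k"
  using upd_fail by auto

lemma ared_nonneg: "0 \<le> ared k"
proof -
  consider "\<eta>1 \<le> \<rho>1 k" | "\<rho>1 k < \<eta>1" "\<eta> \<le> \<rho>2 k" | "\<rho>1 k < \<eta>1" "\<rho>2 k < \<eta>" by linarith
  then show ?thesis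
  proof cases
    case 1
    moreover have "0 \<le> \<eta>1 * pred k (s k)" using trial_decrease_pos[of k] params by simp
    ultimately show ?thesis using successful_iteration(2)[of k] by linarith
  next
    case 2
    moreover have "0 \<le> \<eta> * pred k (\<alpha> k *\<^sub>R sgn (sf k))"
      using stepsize_decrease_pos[of k] params by simp
    ultimately show ?thesis using accepted_iteration(2)[of k] by linarith
  qed (simp add: ared_def rejected_iteration)
qed

lemma norm_xt_le: "norm (xt k) \<le> R + \<Delta>ub"
proof -
  have "norm (xt k - x k) \<le> \<Delta>ub"
  proof (cases "\<eta>1 \<le> \<rho>1 k")
    case True
    then show ?thesis using successful_iteration(1)[OF True] norm_trial_step_le[of k] Delta_le[of k]
      by simp
  next
    case False
    have "norm (\<alpha> k *\<^sub>R sgn (sf k)) \<le> \<Delta>ub"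
      using stepsize_pos[of k] stepsize_le[of k] norm_final_step_le[of k] Delta_le[of k]
        norm_sgn_final_step[of k] by simp
    then show ?thesis
      using False accepted_iteration(1)[of k] rejected_iteration[of k] Delta_pos[of k] Delta_le[of k]
      by (cases "\<eta> \<le> \<rho>2 k") auto
  qed
  then show ?thesis
    using norm_iterate_le[of k] norm_triangle_ineq[of "x k" "xt k - x k"] by simp
qed

lemma eps_antimono:
  assumes "i \<le> j"
  shows "\<epsilon> j \<le> \<epsilon> i"
proof -
  have "decseq \<epsilon>" by (rule decseq_SucI) (use eps_seq(2) in \<open>simp add: less_imp_le\<close>)
  then show ?thesis using assms by (rule decseqD)
qed

text \<open>The merit function of the convergence proof: \<open>psi\<close> plus the Lipschitz price of all the
  truncations that may still happen.\<close>

definition merit :: "nat \<Rightarrow> real" where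
  "merit k = psi (x k) + Lpsi * \<kappa> * (\<Sum>i\<le>m. tail_sum \<epsilon> (c k i))"

lemma merit_decrease: "merit (Suc k) \<le> merit k - ared k"
proof -
  have lip: "Lpsi-lipschitz_on (cball 0 (R + \<Delta>ub + real m * \<kappa> * \<epsilon> 0)) psi"
    using Rlip_ge(1) by (intro lipschitz_on_subset[OF Lpsi(2)] subset_cball)
  have "0 \<le> real (level S m (xt k)) * \<kappa> * \<epsilon> 0"
    using kappa_pos eps_seq(1) by (simp add: less_imp_le)
  then have xt: "norm (xt k) \<le> R + \<Delta>ub + real (level S m (xt k)) * \<kappa> * \<epsilon> 0"
    using norm_xt_le[of k] by linarith
  have "\<And>i. \<epsilon> i \<le> \<epsilon> 0" by (simp add: eps_antimono)
  from trunc_loop_merit_decrease[OF trunc eps_seq(1)[rule_format] eps_seq(4)[rule_format] eps_seq(3)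
      this lip trunc_step[rule_format, of k] xt]
  show ?thesis by (simp add: merit_def ared_def)
qed

lemma merit_bounded_below: "\<exists>b. \<forall>k. b \<le> merit k"
proof -
  obtain b where b: "\<And>y. b \<le> psi y" using A1 by (auto simp: bdd_below_def)
  have "0 \<le> Lpsi * \<kappa> * (\<Sum>i\<le>m. tail_sum \<epsilon> (c k i))" for k
    using Lpsi(1) kappa_pos tail_sum_nonneg[OF eps_seq(3) less_imp_le[OF eps_seq(1)[rule_format]]]
    by (simp add: sum_nonneg)
  then have "b \<le> merit k" for k
    using b[of "x k"] by (simp add: merit_def add_increasing2)
  then show ?thesis by blast
qed

lemma ared_tendsto_zero: "ared \<longlonglongrightarrow> 0"
proof -
  obtain b where b: "\<And>k. b \<le> merit k" using merit_bounded_below by blast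
  have partial_sums: "(\<Sum>k<n. ared k) \<le> merit 0 - merit n" for n
  proof (induction n)
    case (Suc n)
    then show ?case using merit_decrease[of n] by simp
  qed simp
  have "summable ared"
  proof (rule summableI_nonneg_bounded)
    show "0 \<le> ared n" for n by (rule ared_nonneg)
    show "(\<Sum>k<n. ared k) \<le> merit 0 - b" for n using partial_sums[of n] b[of n] by linarith
  qed
  then show ?thesis by (rule summable_LIMSEQ_zero)
qed

abbreviation Gam :: "real^'n \<Rightarrow> ereal" where "Gam \<equiv> Gamma_pt psi"
abbreviation lvl :: "real^'n \<Rightarrow> nat" where "lvl \<equiv> level S m"

lemma Gamma_iterate_ge: "0 < k \<Longrightarrow> ereal (\<epsilon> (c k (lvl (x k)))) \<le> Gam (x k)"
  using trunc_loop_stops[OF trunc_step[rule_format, of "k - 1"]] by (simp add: not_less)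

lemma rejected_iterate_stays:
  assumes "0 < k" "xt k = x k"
  shows "x (Suc k) = x k"
  using trunc_step[rule_format, of k] assms(2)
proof (cases rule: trunc_loop.cases)
  case step
  with Gamma_iterate_ge[OF assms(1)] assms(2) show ?thesis by simp
qed simp

lemma counter_mono: "k \<le> k' \<Longrightarrow> c k i \<le> c k' i"
  using trunc_loop_counters_mono[OF trunc_step[rule_format]] by (rule incseqD[OF incseq_SucI])

lemma counter_changes_below_level: "c (Suc k) j \<noteq> c k j \<Longrightarrow> j < lvl (x (Suc k))"
  by (rule trunc_loop_counter_changes_below_level[OF trunc eps_seq(1)[rule_format]
        eps_seq(4)[rule_format] trunc_step[rule_format]])

text \<open>If \<open>Gam (x k) \<rightarrow> 0\<close>, the counters are bounded, level by level from the top: once the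
  counters above level \<open>j\<close> are bounded by \<open>N\<close> and \<open>Gam (x k) < \<epsilon> N\<close>, the stopping rule of the
  truncation loop forces \<open>lvl (x k) \<le> j\<close>, so the counter of level \<open>j\<close> no longer changes.\<close>

lemma counters_bounded_if_Gamma_vanishes:
  assumes Gam0: "\<And>e. 0 < e \<Longrightarrow> \<forall>\<^sub>F k in sequentially. Gam (x k) < ereal e" and "j \<le> Suc m"
  shows "\<exists>N. \<forall>k i. j \<le> i \<longrightarrow> i \<le> m \<longrightarrow> c k i \<le> N"
  using assms(2)
proof (induction j rule: inc_induct)
  case (step j)
  then obtain N where N: "\<And>k i. Suc j \<le> i \<Longrightarrow> i \<le> m \<Longrightarrow> c k i \<le> N" by blast
  obtain K where K: "\<And>k. K \<le> k \<Longrightarrow> Gam (x k) < ereal (\<epsilon> N)"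
    using Gam0[OF eps_seq(1)[rule_format]] by (auto simp: eventually_sequentially)
  define K' where "K' = Suc K"
  have low: "lvl (x k) \<le> j" if "K' \<le> k" for k
  proof (rule ccontr)
    assume "\<not> lvl (x k) \<le> j"
    then have "\<epsilon> N \<le> \<epsilon> (c k (lvl (x k)))"
      using N level_spec[OF trunc] by (intro eps_antimono) auto
    then have "ereal (\<epsilon> N) \<le> Gam (x k)"
      using Gamma_iterate_ge[of k] that by (simp add: K'_def) (meson ereal_less_eq(3) order_trans)
    then show False using K[of k] that by (simp add: K'_def)
  qed
  have const: "c k j = c K' j" if "K' \<le> k" for k
    using that
  proof (induction k rule: nat_induct_at_least)
    case (Suc k)
    have "lvl (x (Suc k)) \<le> j" using low Suc.hyps by simp
    then have "c (Suc k) j = c k j" using counter_changes_below_level[of k j] by linarith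
    with Suc.IH show ?case by simp
  qed simp
  have cj: "c k j \<le> c K' j" for k
    by (cases "K' \<le> k") (simp_all add: const[of k] counter_mono)
  have "c k i \<le> max N (c K' j)" if "j \<le> i" "i \<le> m" for k i
  proof (cases "i = j")
    case True
    then show ?thesis using cj[of k] by simp
  next
    case False
    then show ?thesis using N[of i k] that by simp
  qed
  then show ?case by blast
qed simp

lemma Gamma_frequently_ge: "\<exists>e>0. \<exists>\<^sub>F k in sequentially. ereal e \<le> Gam (x k)"
proof (rule ccontr)
  assume "\<not> ?thesis"
  then have Gam0: "\<And>e. 0 < e \<Longrightarrow> \<forall>\<^sub>F k in sequentially. Gam (x k) < ereal e"
    by (simp add: not_frequently not_le)
  obtain N where N: "\<And>k i. i \<le> m \<Longrightarrow> c k i \<le> N"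
    using counters_bounded_if_Gamma_vanishes[OF Gam0, of 0] by auto
  obtain K where K: "\<And>k. K \<le> k \<Longrightarrow> Gam (x k) < ereal (\<epsilon> N)"
    using Gam0[OF eps_seq(1)[rule_format]] by (auto simp: eventually_sequentially)
  have "\<epsilon> N \<le> \<epsilon> (c (Suc K) (lvl (x (Suc K))))"
    using N level_spec[OF trunc] by (intro eps_antimono) auto
  then have "ereal (\<epsilon> N) \<le> Gam (x (Suc K))"
    using Gamma_iterate_ge[of "Suc K"] by (meson ereal_less_eq(3) order_trans zero_less_Suc)
  with K[of "Suc K"] show False by simp
qed

lemma trial_decrease_lower_bound:
  assumes "0 < ep" "ep \<le> norm (g k)" "0 < Dh" "Dh \<le> \<Delta> k"
  shows "\<gamma>1 / 2 * ep * min Dh (\<gamma>2 * ep) \<le> pred k (s k)"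
proof -
  have "\<gamma>1 / 2 * ep * min Dh (\<gamma>2 * ep) \<le> \<gamma>1 / 2 * norm (g k) * min (\<Delta> k) (\<gamma>2 * norm (g k))"
    using assms params by (intro mult_mono min.mono) auto
  with trial_decrease_ge[of k] show ?thesis by linarith
qed

lemma trial_direction_alignment:
  assumes "sf k = s k" "\<kappa>q * \<Delta> k \<le> norm (g k)"
  shows "norm (g k) * (1 - d (x k) \<bullet> sgn (s k)) \<le> \<kappa>q * \<Delta> k"
proof -
  define G p n where "G = norm (g k)" and "p = d (x k) \<bullet> sgn (s k)" and "n = norm (s k)"
  have n: "0 < n" "n \<le> \<Delta> k" using trial_step_nonzero norm_trial_step_le by (auto simp: n_def)
  have "s k = n *\<^sub>R sgn (s k)" using n by (simp add: n_def sgn_div_norm)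
  then have "g k \<bullet> s k = (- G *\<^sub>R d (x k)) \<bullet> (n *\<^sub>R sgn (s k))"
    by (metis G_def g_eq)
  then have "- (g k \<bullet> s k) = G * n * p" by (simp add: p_def)
  moreover have "- (1/2 * (s k \<bullet> (B k *v s k))) \<le> \<kappa>q * (\<Delta> k)\<^sup>2 / 2"
  proof -
    have "(norm (s k))\<^sup>2 \<le> (\<Delta> k)\<^sup>2" using n by (intro power_mono) (auto simp: n_def)
    then have "\<kappa>q * (norm (s k))\<^sup>2 \<le> \<kappa>q * (\<Delta> k)\<^sup>2" using kappa_q_pos by simp
    with abs_le_D2[OF quadratic_term_le[of "s k" k]] show ?thesis by linarith
  qed
  ultimately have upper: "pred k (s k) \<le> G * n * p + \<kappa>q * (\<Delta> k)\<^sup>2 / 2" by (simp add: pred_eq)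
  have "\<Delta> k * G - \<kappa>q * (\<Delta> k)\<^sup>2 / 2 \<le> pred k (s k)"
    using cauchy_decrease_ge[of "\<Delta> k" k] trial_decrease_ge_cauchy[of k] Delta_pos[of k]
    by (simp add: G_def mult.commute)
  with upper have key: "\<Delta> k * (G - \<kappa>q * \<Delta> k) \<le> G * n * p"
    by (simp add: power2_eq_square algebra_simps)
  have "0 \<le> p"
  proof (rule ccontr)
    assume "\<not> 0 \<le> p"
    then have "G * n * p < 0" using n g_norm_pos[of k] by (simp add: G_def mult_pos_neg)
    moreover have "0 \<le> \<Delta> k * (G - \<kappa>q * \<Delta> k)" using assms(2) Delta_pos[of k] by (simp add: G_def)
    ultimately show False using key by linarith
  qed
  then have "G * n * p \<le> G * \<Delta> k * p"
    using n g_norm_pos[of k] by (intro mult_right_mono mult_left_mono) (auto simp: G_def)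
  with key have "\<Delta> k * (G - \<kappa>q * \<Delta> k) \<le> \<Delta> k * (G * p)" by (simp add: mult_ac)
  then have "G - \<kappa>q * \<Delta> k \<le> G * p" using Delta_pos[of k] by simp
  then show ?thesis by (simp add: G_def p_def algebra_simps)
qed

lemma dir_deriv_minus_model_slope_le:
  assumes "norm v = 1"
  shows "dir_deriv psi (x k) v - g k \<bullet> v \<le> Lpsi * norm (v - d (x k))"
proof -
  have "dir_deriv psi (x k) v \<le> dir_deriv psi (x k) (d (x k)) + Lpsi * norm (v - d (x k))"
    using dir_deriv_psi_lipschitz[OF norm_iterate_le, of v "d (x k)" k] assms d_unit[of k] by simp
  moreover have "d (x k) \<bullet> v \<le> 1"
    using Cauchy_Schwarz_ineq2[of "d (x k)" v] assms d_unit[of k] by simp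
  then have "- norm (g k) \<le> g k \<bullet> v"
    using g_norm_pos[of k] by (subst g_eq) (simp add: mult_le_cancel_left1)
  ultimately show ?thesis using dir_deriv_d_le[of k] by linarith
qed

context
  fixes ep :: real and K0 :: nat
  assumes ep: "0 < ep" and g_ge: "\<And>k. K0 \<le> k \<Longrightarrow> ep \<le> norm (g k)"
begin

definition c0 :: real where "c0 = min (ep / 2) (\<gamma>1 * ep / 4)"
definition \<mu> :: real where "\<mu> = (1 - \<eta>2) * c0 / 4"
definition \<Delta>small :: real where
  "\<Delta>small = min (min (\<gamma>2 * ep) (ep / \<kappa>q)) (min (2 * \<mu> / \<kappa>q) (ep * \<mu>\<^sup>2 / (2 * \<kappa>q * Lpsi\<^sup>2)))"

lemma c0_pos: "0 < c0" using ep params by (simp add: c0_def)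
lemma mu_pos: "0 < \<mu>" using c0_pos params by (simp add: \<mu>_def)
lemma Delta_small_pos: "0 < \<Delta>small"
  using ep params mu_pos kappa_q_pos Lpsi(1) by (simp add: \<Delta>small_def)

lemma stepsize_decrease_ge_small_radius:
  assumes "K0 \<le> k" "\<Delta> k \<le> \<gamma>2 * ep"
  shows "c0 * \<alpha> k \<le> pred k (\<alpha> k *\<^sub>R sgn (sf k))"
proof -
  have G: "ep \<le> norm (g k)" using g_ge assms(1) .
  then have "\<gamma>1 * ep \<le> \<gamma>1 * norm (g k)" "\<gamma>2 * ep \<le> \<gamma>2 * norm (g k)" using params by simp_all
  then have c0: "c0 \<le> min (norm (g k) / 2) (\<gamma>1 * norm (g k) / 4)"
    and "min (\<Delta> k) (\<gamma>2 * norm (g k)) = \<Delta> k"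
    using G assms(2) by (auto simp: c0_def)
  then have "\<gamma>1 / 2 * norm (g k) * \<Delta> k \<le> pred k (s k)" using trial_decrease_ge[of k] by simp
  from stepsize_decrease_ge_linear[OF this]
  have "\<alpha> k * min (norm (g k) / 2) (\<gamma>1 * norm (g k) / 4) \<le> pred k (\<alpha> k *\<^sub>R sgn (sf k))"
    using params g_norm_pos[of k] Delta_pos[of k] by simp
  moreover have "\<alpha> k * c0 \<le> \<alpha> k * min (norm (g k) / 2) (\<gamma>1 * norm (g k) / 4)"
    using c0 stepsize_pos[of k] by (intro mult_left_mono) auto
  ultimately show ?thesis by (simp add: mult.commute)
qed

lemma final_direction_close:
  assumes "K0 \<le> k" "\<Delta> k \<le> \<Delta>small"
  shows "Lpsi * norm (sgn (sf k) - d (x k)) \<le> \<mu>"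
proof (cases "sf k = s k")
  case True
  define p where "p = d (x k) \<bullet> sgn (s k)"
  have G: "ep \<le> norm (g k)" using g_ge assms(1) .
  have \<Delta>: "\<Delta> k \<le> ep / \<kappa>q" "\<Delta> k \<le> ep * \<mu>\<^sup>2 / (2 * \<kappa>q * Lpsi\<^sup>2)"
    using assms(2) by (auto simp: \<Delta>small_def)
  then have "\<kappa>q * \<Delta> k \<le> ep" using kappa_q_pos by (simp add: pos_le_divide_eq mult.commute)
  then have "norm (g k) * (1 - p) \<le> \<kappa>q * \<Delta> k"
    using trial_direction_alignment[OF True] G by (simp add: p_def)
  moreover have "p \<le> 1"
    using Cauchy_Schwarz_ineq2[of "d (x k)" "sgn (s k)"] d_unit[of k] norm_sgn_final_step[of k] True
    by (simp add: p_def)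
  moreover have "ep * (1 - p) \<le> norm (g k) * (1 - p)"
    using G \<open>p \<le> 1\<close> by (intro mult_right_mono) auto
  ultimately have "ep * (1 - p) \<le> \<kappa>q * \<Delta> k" by linarith
  also have "\<dots> \<le> \<kappa>q * (ep * \<mu>\<^sup>2 / (2 * \<kappa>q * Lpsi\<^sup>2))"
    using \<Delta>(2) kappa_q_pos by (intro mult_left_mono) auto
  also have "\<dots> = ep * (\<mu>\<^sup>2 / (2 * Lpsi\<^sup>2))" using kappa_q_pos by simp
  finally have p_close: "1 - p \<le> \<mu>\<^sup>2 / (2 * Lpsi\<^sup>2)" using ep by (rule mult_left_le_imp_le)
  have dist_sq: "(norm (sgn (sf k) - d (x k)))\<^sup>2 = 2 * (1 - p)"
  proof -
    have "sgn (s k) \<bullet> sgn (s k) = 1" "d (x k) \<bullet> d (x k) = 1"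
      using True norm_sgn_final_step[of k] d_unit[of k] by (simp_all add: dot_square_norm)
    then show ?thesis
      using True by (simp add: power2_norm_eq_inner inner_diff_left inner_diff_right p_def inner_commute)
  qed
  have "(Lpsi * norm (sgn (sf k) - d (x k)))\<^sup>2 = Lpsi\<^sup>2 * (2 * (1 - p))"
    by (simp add: power_mult_distrib dist_sq)
  also have "\<dots> \<le> Lpsi\<^sup>2 * (2 * (\<mu>\<^sup>2 / (2 * Lpsi\<^sup>2)))"
    using p_close by (intro mult_left_mono) auto
  also have "\<dots> = \<mu>\<^sup>2" using Lpsi(1) by simp
  finally have "(Lpsi * norm (sgn (sf k) - d (x k)))\<^sup>2 \<le> \<mu>\<^sup>2" .
  then show ?thesis by (rule power2_le_imp_le) (use mu_pos in simp)
next
  case False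
  then have "sf k = sC k" using final_step_cases[of k] by blast
  then show ?thesis using sgn_cauchy_point[of k] mu_pos by simp
qed

text \<open>For small radii the ratio \<open>\<rho>2\<close> exceeds \<open>\<eta>2\<close>: the model error of the directional step is
  \<open>O(\<mu> \<alpha>)\<close>, whereas the predicted decrease is at least \<open>c0 \<alpha> = 4 \<mu> \<alpha> / (1 - \<eta>2)\<close>.\<close>

lemma rho2_gt_eta2:
  assumes "K0 \<le> k" "\<Delta> k \<le> \<Delta>small"
    and remainder: "\<bar>psi (x k + \<alpha> k *\<^sub>R sgn (sf k)) - psi (x k)
        - \<alpha> k * dir_deriv psi (x k) (sgn (sf k))\<bar> \<le> \<mu> * \<alpha> k"
  shows "\<eta>2 < \<rho>2 k"
proof -
  define v a where "v = sgn (sf k)" and "a = \<alpha> k"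
  define num den where "num = psi (x k) - psi (x k + a *\<^sub>R v)" and "den = pred k (a *\<^sub>R v)"
  have a: "0 < a" "a \<le> \<Delta> k" using stepsize_pos stepsize_le norm_final_step_le
    by (auto simp: a_def intro: order_trans)
  have v: "norm v = 1" using norm_sgn_final_step by (simp add: v_def)
  have small: "\<Delta> k \<le> \<gamma>2 * ep" "\<kappa>q * \<Delta> k \<le> 2 * \<mu>"
    using assms(2) kappa_q_pos by (auto simp: \<Delta>small_def pos_le_divide_eq mult.commute)
  have den: "c0 * a \<le> den"
    using stepsize_decrease_ge_small_radius[OF assms(1) small(1)] by (simp add: den_def a_def v_def)
  have slope: "a * (dir_deriv psi (x k) v - g k \<bullet> v) \<le> a * \<mu>"
    using dir_deriv_minus_model_slope_le[OF v, of k] final_direction_close[OF assms(1,2)] a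
    by (intro mult_left_mono) (auto simp: v_def)
  have "\<kappa>q * a \<le> \<kappa>q * \<Delta> k" using a kappa_q_pos by simp
  then have "a * (\<kappa>q * a) \<le> a * (2 * \<mu>)"
    using a small(2) by (intro mult_left_mono) auto
  moreover have "- \<kappa>q \<le> v \<bullet> (B k *v v)"
    using abs_le_D2[OF quadratic_term_le[of v k]] v by simp
  then have "a\<^sup>2 / 2 * (- \<kappa>q) \<le> a\<^sup>2 / 2 * (v \<bullet> (B k *v v))" by (rule mult_left_mono) simp
  ultimately have curvature: "- (a * \<mu>) \<le> a\<^sup>2 / 2 * (v \<bullet> (B k *v v))"
    by (simp add: power2_eq_square algebra_simps)
  have "den = a * (- (g k \<bullet> v)) - a\<^sup>2 / 2 * (v \<bullet> (B k *v v))"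
    by (simp add: den_def pred_eq matrix_vector_mult_scaleR power2_eq_square algebra_simps)
  then have "num - den \<ge> - 3 * (\<mu> * a)"
    using slope curvature remainder by (simp add: num_def a_def v_def algebra_simps)
  moreover have "(1 - \<eta>2) * (c0 * a) = 4 * (\<mu> * a)" by (simp add: \<mu>_def)
  moreover have "(1 - \<eta>2) * (c0 * a) \<le> (1 - \<eta>2) * den"
    using den params by (intro mult_left_mono) auto
  moreover have "0 < \<mu> * a" using mu_pos a by simp
  ultimately have "\<eta>2 * den < num" by (simp add: algebra_simps)
  moreover have "0 < den" using stepsize_decrease_pos by (simp add: den_def a_def v_def)
  ultimately show ?thesis
    using rho2_def by (simp add: num_def den_def a_def v_def pos_less_divide_eq)
qed

text \<open>Along a subsequence of iterates with vanishing radii (B.3) applies after passing to a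
  convergent subsequence, which exists by (B.1).\<close>

lemma rho2_gt_eta2_along_subseq:
  assumes r: "strict_mono r" "(\<lambda>n. \<Delta> (r n)) \<longlonglongrightarrow> 0" "\<And>n. K0 \<le> r n"
  shows "\<exists>n. \<eta>2 < \<rho>2 (r n)"
proof -
  have "\<forall>n. (x \<circ> r) n \<in> cball 0 R" using norm_iterate_le by simp
  then obtain l q where q: "strict_mono q" "((x \<circ> r) \<circ> q) \<longlonglongrightarrow> l"
    using seq_compactE[OF compact_imp_seq_compact[OF compact_cball]] by metis
  define r' where "r' = r \<circ> q"
  have \<Delta>0: "(\<lambda>l. \<Delta> (r' l)) \<longlonglongrightarrow> 0"
    using LIMSEQ_subseq_LIMSEQ[OF r(2) q(1)] by (simp add: r'_def o_def)
  have "0 \<le> \<alpha> k" "\<alpha> k \<le> \<Delta> k" for k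
    using stepsize_pos[of k] order_trans[OF stepsize_le norm_final_step_le] by simp_all
  then have "(\<lambda>l. \<alpha> (r' l)) \<longlonglongrightarrow> 0"
    by (intro tendsto_sandwich[OF _ _ tendsto_const \<Delta>0] always_eventually allI)
  moreover have "convergent (\<lambda>l. x (r' l))"
    using q(2) by (auto simp: r'_def convergent_def o_def)
  moreover have "strict_mono r'" using r(1) q(1) by (simp add: r'_def strict_mono_o)
  ultimately have "(\<lambda>l. psi (x (r' l) + \<alpha> (r' l) *\<^sub>R sgn (sf (r' l))) - psi (x (r' l))
      - \<alpha> (r' l) * dir_deriv psi (x (r' l)) (sgn (sf (r' l)))) \<in> o(\<lambda>l. \<alpha> (r' l))"
    using B3 by blast
  from landau_o.smallD[OF this mu_pos]
  have "\<forall>\<^sub>F l in sequentially. \<bar>psi (x (r' l) + \<alpha> (r' l) *\<^sub>R sgn (sf (r' l))) - psi (x (r' l))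
      - \<alpha> (r' l) * dir_deriv psi (x (r' l)) (sgn (sf (r' l)))\<bar> \<le> \<mu> * \<alpha> (r' l)"
    using stepsize_pos by (simp add: less_imp_le)
  moreover have "\<forall>\<^sub>F l in sequentially. \<Delta> (r' l) \<le> \<Delta>small"
    using order_tendstoD(2)[OF \<Delta>0 Delta_small_pos] by (auto elim: eventually_mono)
  ultimately have "\<forall>\<^sub>F l in sequentially. \<eta>2 < \<rho>2 (r' l)"
  proof eventually_elim
    case (elim l)
    then show ?case using rho2_gt_eta2[of "r' l"] r(3)[of "q l"] by (simp add: r'_def)
  qed
  then obtain l where "\<eta>2 < \<rho>2 (r (q l))" by (auto simp: eventually_sequentially r'_def)
  then show ?thesis by blast
qed

lemma small_radius_imp_rho2_gt_eta2: "\<exists>D>0. \<exists>K. \<forall>k\<ge>K. \<Delta> k < D \<longrightarrow> \<eta>2 < \<rho>2 k"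
proof (rule ccontr)
  assume contra: "\<not> ?thesis"
  have "\<exists>k\<ge>K. \<Delta> k < D \<and> \<rho>2 k \<le> \<eta>2 \<and> K0 \<le> k" if "0 < D" for D K
  proof (rule ccontr)
    assume "\<not> (\<exists>k\<ge>K. \<Delta> k < D \<and> \<rho>2 k \<le> \<eta>2 \<and> K0 \<le> k)"
    then have "\<forall>k\<ge>max K K0. \<Delta> k < D \<longrightarrow> \<eta>2 < \<rho>2 k" by (auto simp: not_le)
    with that contra show False by blast
  qed
  from subseq_tendsto_zero[where a = \<Delta> and P = "\<lambda>k. \<rho>2 k \<le> \<eta>2 \<and> K0 \<le> k",
      OF this less_imp_le[OF Delta_pos]]
  obtain r where r: "strict_mono r" "(\<lambda>n. \<Delta> (r n)) \<longlonglongrightarrow> 0" "\<And>n. \<rho>2 (r n) \<le> \<eta>2 \<and> K0 \<le> r n"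
    by blast
  have "\<And>n. K0 \<le> r n" using r(3) by blast
  from rho2_gt_eta2_along_subseq[OF r(1,2) this] obtain n where "\<eta>2 < \<rho>2 (r n)" by blast
  with r(3)[of n] show False by simp
qed

lemma radius_bounded_below: "\<exists>Dh>0. \<exists>K. \<forall>k\<ge>K. Dh \<le> \<Delta> k"
proof -
  obtain D K where D: "0 < D" "\<And>k. K \<le> k \<Longrightarrow> \<Delta> k < D \<Longrightarrow> \<eta>2 < \<rho>2 k"
    using small_radius_imp_rho2_gt_eta2 by blast
  define Dh where "Dh = min (\<Delta> K) (min (r1 * D) \<Delta>max)"
  have "Dh \<le> \<Delta> k" if "K \<le> k" for k
    using that
  proof (induction k rule: nat_induct_at_least)
    case (Suc k)
    have "\<Delta> k \<le> r2 * \<Delta> k" using Delta_pos[of k] params by simp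
    then have expand: "Dh \<le> min \<Delta>max (r2 * \<Delta> k)" using Suc.IH by (simp add: Dh_def)
    consider "\<eta>1 \<le> \<rho>1 k" | "\<rho>1 k < \<eta>1" "\<rho>2 k < \<eta>1" | "\<rho>1 k < \<eta>1" "\<eta>1 \<le> \<rho>2 k"
      by linarith
    then show ?case
    proof cases
      case 1
      then show ?thesis using upd_succ[rule_format, of k] expand Suc.IH by auto
    next
      case 2
      then have "D \<le> \<Delta> k" using D(2)[OF Suc.hyps] params by force
      then have "r1 * D \<le> r1 * \<Delta> k" using params by simp
      then show ?thesis using 2 upd_fail[rule_format, of k] by (simp add: Dh_def)
    next
      case 3
      then show ?thesis using upd_fail[rule_format, of k] expand Suc.IH by auto
    qed
  qed (simp add: Dh_def)
  moreover have "0 < Dh" using D Delta_pos params by (simp add: Dh_def)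
  ultimately show ?thesis by blast
qed

lemma eventually_unsuccessful: "\<exists>Dh>0. \<exists>K. \<forall>k\<ge>K. Dh \<le> \<Delta> k \<and> \<rho>1 k < \<eta>1"
proof -
  obtain Dh K where Dh: "0 < Dh" "\<And>k. K \<le> k \<Longrightarrow> Dh \<le> \<Delta> k"
    using radius_bounded_below by blast
  define \<theta> where "\<theta> = \<eta>1 * (\<gamma>1 / 2 * ep * min Dh (\<gamma>2 * ep))"
  have "0 < \<theta>" using Dh ep params by (simp add: \<theta>_def)
  then obtain N where N: "\<And>k. N \<le> k \<Longrightarrow> ared k < \<theta>"
    using order_tendstoD(2)[OF ared_tendsto_zero] by (auto simp: eventually_sequentially)
  have "\<rho>1 k < \<eta>1" if "max (max K0 K) N \<le> k" for k
  proof (rule ccontr)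
    assume "\<not> \<rho>1 k < \<eta>1"
    then have "\<eta>1 * pred k (s k) \<le> ared k" using successful_iteration(2) by simp
    moreover have "\<gamma>1 / 2 * ep * min Dh (\<gamma>2 * ep) \<le> pred k (s k)"
      using trial_decrease_lower_bound ep g_ge Dh that by auto
    then have "\<theta> \<le> \<eta>1 * pred k (s k)" unfolding \<theta>_def using params by (intro mult_left_mono) auto
    ultimately have "\<theta> \<le> ared k" by linarith
    then show False using N that by force
  qed
  with Dh show ?thesis by (metis max.bounded_iff)
qed

definition step_bound :: "real \<Rightarrow> real" where
  "step_bound Dh = min (\<gamma>1 / 2 * ep * min Dh (\<gamma>2 * ep)) (min Dh (ep / \<kappa>q) * ep / 2)"

lemma step_bound_pos: "0 < Dh \<Longrightarrow> 0 < step_bound Dh"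
  using ep params kappa_q_pos by (simp add: step_bound_def)

lemma final_decrease_ge:
  assumes "K0 \<le> k" "0 < Dh" "Dh \<le> \<Delta> k"
  shows "step_bound Dh \<le> pred k (sf k)"
proof (cases "sf k = sC k")
  case True
  define \<tau> where "\<tau> = min Dh (ep / \<kappa>q)"
  have "\<tau> \<le> ep / \<kappa>q" by (simp add: \<tau>_def)
  then have "\<kappa>q * \<tau> \<le> \<kappa>q * (ep / \<kappa>q)" using kappa_q_pos by (intro mult_left_mono) auto
  then have \<tau>: "0 \<le> \<tau>" "\<tau> \<le> \<Delta> k" "\<kappa>q * \<tau> \<le> ep"
    using assms ep kappa_q_pos by (auto simp: \<tau>_def)
  then have "\<kappa>q * \<tau>\<^sup>2 / 2 \<le> \<tau> * norm (g k) / 2"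
    using g_ge[OF assms(1)] mult_left_mono[of "\<kappa>q * \<tau>" "norm (g k)" \<tau>]
    by (simp add: power2_eq_square mult_ac)
  moreover have "\<tau> * ep \<le> \<tau> * norm (g k)" using g_ge[OF assms(1)] \<tau>(1) by (rule mult_left_mono)
  ultimately have "\<tau> * ep / 2 \<le> pred k (sC k)" using cauchy_decrease_ge[OF \<tau>(1,2)] by linarith
  then show ?thesis using True by (simp add: step_bound_def \<tau>_def min.coboundedI2)
next
  case False
  then show ?thesis
    using final_step_cases[of k] trial_decrease_lower_bound[OF ep g_ge[OF assms(1)] assms(2,3)]
    by (auto simp: step_bound_def min.coboundedI1)
qed

lemma accepted_decrease_ge:
  assumes "K0 \<le> k" "0 < Dh" "Dh \<le> \<Delta> k" "\<rho>1 k < \<eta>1" "\<eta> \<le> \<rho>2 k"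
    and "0 < e'" "ereal e' \<le> Gs (x k) (sgn (sf k))"
  shows "\<eta> * (min (ep / 2) (\<gamma>1 / 2 * ep * min Dh (\<gamma>2 * ep) / (2 * \<Delta>ub))
      * min e' (min 1 (step_bound Dh / (Lpsi + \<kappa>q)))) \<le> ared k"
proof -
  define \<theta> where "\<theta> = \<gamma>1 / 2 * ep * min Dh (\<gamma>2 * ep)"
  define c1 where "c1 = min (ep / 2) (\<theta> / (2 * \<Delta>ub))"
  have \<theta>: "0 \<le> \<theta>" "\<theta> \<le> pred k (s k)"
    using ep params assms(2) trial_decrease_lower_bound[OF ep g_ge[OF assms(1)] assms(2,3)]
    by (simp_all add: \<theta>_def)
  have "min 1 (step_bound Dh / (Lpsi + \<kappa>q)) \<le> norm (sf k)"
    using norm_ge_if_pred_ge[OF final_decrease_ge[OF assms(1-3)] step_bound_pos[OF assms(2)]] .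
  then have M: "min e' (min 1 (step_bound Dh / (Lpsi + \<kappa>q))) \<le> \<alpha> k"
    using stepsize_ge[OF assms(7)] by linarith
  have c1_le: "c1 \<le> min (norm (g k) / 2) (\<theta> / (2 * \<Delta> k))"
    using g_ge[OF assms(1)] \<theta>(1) Delta_pos[of k] Delta_le[of k]
    by (auto simp: c1_def min_le_iff_disj intro: divide_left_mono)
  have "0 \<le> c1" using ep \<theta>(1) Delta_pos[of 0] Delta_le[of 0] by (simp add: c1_def)
  with M have "c1 * min e' (min 1 (step_bound Dh / (Lpsi + \<kappa>q))) \<le> c1 * \<alpha> k"
    by (simp add: mult_left_mono)
  also have "\<dots> \<le> \<alpha> k * min (norm (g k) / 2) (\<theta> / (2 * \<Delta> k))"
    using c1_le stepsize_pos[of k] by (simp add: mult.commute mult_left_mono)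
  also have "\<dots> \<le> pred k (\<alpha> k *\<^sub>R sgn (sf k))"
    by (rule stepsize_decrease_ge_linear[OF \<theta>(2,1)])
  finally have "\<eta> * (c1 * min e' (min 1 (step_bound Dh / (Lpsi + \<kappa>q))))
      \<le> \<eta> * pred k (\<alpha> k *\<^sub>R sgn (sf k))"
    using params by (intro mult_left_mono) auto
  with accepted_iteration(2)[OF assms(4,5)] show ?thesis by (simp add: c1_def \<theta>_def)
qed

lemma accepted_steps_eventually_small_Gamma:
  assumes "0 < Dh" "\<And>k. K \<le> k \<Longrightarrow> Dh \<le> \<Delta> k \<and> \<rho>1 k < \<eta>1" "0 < e"
  shows "\<exists>K'. \<forall>k\<ge>K'. \<eta> \<le> \<rho>2 k \<longrightarrow> Gam (x k) < ereal e"
proof -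
  obtain e' where e': "0 < e'" "\<And>k. ereal e \<le> Gam (x k) \<Longrightarrow> ereal e' \<le> Gs (x k) (sgn (sf k))"
    using B4 assms(3) by blast
  define th where "th = \<eta> * (min (ep / 2) (\<gamma>1 / 2 * ep * min Dh (\<gamma>2 * ep) / (2 * \<Delta>ub))
      * min e' (min 1 (step_bound Dh / (Lpsi + \<kappa>q))))"
  have "0 < th"
    using params ep assms(1) e'(1) step_bound_pos[OF assms(1)] Delta_pos[of 0] Delta_le[of 0]
      Lpsi(1) kappa_q_pos
    by (simp add: th_def)
  then obtain N where N: "\<And>k. N \<le> k \<Longrightarrow> ared k < th"
    using order_tendstoD(2)[OF ared_tendsto_zero] by (auto simp: eventually_sequentially)
  have "Gam (x k) < ereal e" if "max (max K0 K) N \<le> k" "\<eta> \<le> \<rho>2 k" for k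
    using accepted_decrease_ge[of k Dh, OF _ assms(1) _ _ that(2) e'(1) e'(2)] assms(2)[of k] N[of k]
      that(1)
    by (force simp: th_def not_less[symmetric])
  then show ?thesis by blast
qed

text \<open>From some index on, every iteration is unsuccessful while the radius stays above \<open>Dh\<close>;
  when \<open>Gam (x k) \<ge> e\<close>, accepted directional steps are excluded as well, so the iterate stays put and
  the radius shrinks geometrically below \<open>Dh\<close>.\<close>

lemma norm_g_not_eventually_bounded_below: False
proof -
  obtain Dh K where D: "0 < Dh" "\<And>k. K \<le> k \<Longrightarrow> Dh \<le> \<Delta> k \<and> \<rho>1 k < \<eta>1"
    using eventually_unsuccessful by blast
  obtain e where e: "0 < e" "\<exists>\<^sub>F k in sequentially. ereal e \<le> Gam (x k)"
    using Gamma_frequently_ge by blast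
  obtain K' where K': "\<And>k. K' \<le> k \<Longrightarrow> \<eta> \<le> \<rho>2 k \<Longrightarrow> Gam (x k) < ereal e"
    using accepted_steps_eventually_small_Gamma[OF D e(1)] by blast
  from e(2) obtain k where k: "max K' (Suc K) \<le> k" "ereal e \<le> Gam (x k)"
    unfolding frequently_sequentially by blast
  have shrink: "x (k + j) = x k \<and> \<Delta> (k + j) = r1 ^ j * \<Delta> k" for j
  proof (induction j)
    case (Suc j)
    let ?k = "k + j"
    have "\<rho>1 ?k < \<eta>1" "\<rho>2 ?k < \<eta>"
      using D(2)[of ?k] K'[of ?k] k Suc.IH by (auto simp: not_le[symmetric])
    then have "xt ?k = x ?k" "\<Delta> (Suc ?k) = r1 * \<Delta> ?k"
      using rejected_iteration upd_fail params by auto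
    then show ?case using rejected_iterate_stays[of ?k] k Suc.IH by simp
  qed simp
  obtain j where "r1 ^ j < Dh / \<Delta> k"
    using real_arch_pow_inv[of "Dh / \<Delta> k" r1] D(1) Delta_pos[of k] params by auto
  then have "\<Delta> (k + j) < Dh" using shrink[of j] Delta_pos[of k] by (simp add: pos_less_divide_eq)
  with D(2)[of "k + j"] k show False by simp
qed

end

lemma liminf_norm_g_eq_0: "liminf (\<lambda>k. ereal (norm (g k))) = 0"
proof (rule ccontr)
  assume "liminf (\<lambda>k. ereal (norm (g k))) \<noteq> 0"
  moreover have "0 \<le> liminf (\<lambda>k. ereal (norm (g k)))" by (rule Liminf_bounded) simp
  ultimately obtain ep where ep: "0 < ereal ep" "ereal ep < liminf (\<lambda>k. ereal (norm (g k)))"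
    using ereal_dense2 by (metis order_le_neq_trans)
  from less_LiminfD[OF ep(2)] obtain K0 where "\<forall>k\<ge>K0. ep < norm (g k)"
    by (auto simp: eventually_sequentially)
  then have "\<And>k. K0 \<le> k \<Longrightarrow> ep \<le> norm (g k)" by (simp add: less_imp_le)
  moreover have "0 < ep" using ep(1) by simp
  ultimately show False using norm_g_not_eventually_bounded_below by blast
qed

end

theorem theorem4p8:
  fixes f phi psi :: "real^'n \<Rightarrow> real" and gradf :: "real^'n \<Rightarrow> real^'n"
    and u :: "real^'n \<Rightarrow> real" and d :: "real^'n \<Rightarrow> real^'n"
    and Gs :: "real^'n \<Rightarrow> real^'n \<Rightarrow> ereal"
    and S :: "nat \<Rightarrow> (real^'n) set" and m :: nat and \<delta> :: ereal and \<kappa> :: real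
    and T :: "real^'n \<Rightarrow> real \<Rightarrow> real^'n"
    and \<eta> \<eta>1 \<eta>2 r1 r2 \<Delta>max \<gamma>1 \<gamma>2 :: real
    and \<epsilon> :: "nat \<Rightarrow> real" and ell :: "real \<Rightarrow> real"
    and x :: "nat \<Rightarrow> real^'n" and \<Delta> :: "nat \<Rightarrow> real" and c :: "nat \<Rightarrow> nat \<Rightarrow> nat"
    and B :: "nat \<Rightarrow> real^'n^'n"
    and g sC s sf xt :: "nat \<Rightarrow> real^'n"
    and aC \<alpha>0 \<alpha> \<rho>1 \<rho>2 :: "nat \<Rightarrow> real"
    and R \<kappa>B :: real
  \<comment> \<open>problem data\<close>
  assumes f_C1: "\<forall>y. (f has_derivative (\<lambda>h. gradf y \<bullet> h)) (at y)" "continuous_on UNIV gradf"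
    and phi_convex: "convex_on UNIV phi"
    and psi_def: "psi = (\<lambda>y. f y + phi y)"
  \<comment> \<open>pseudo-gradient g(y) = u(y) d(y)\<close>
    and pg_nonstat: "\<forall>y. \<not> stationary gradf phi y \<longrightarrow>
          norm (d y) = 1 \<and> dir_deriv psi y (d y) < 0 \<and> dir_deriv psi y (d y) \<le> u y \<and> u y < 0"
    and pg_stat: "\<forall>y. stationary gradf phi y \<longrightarrow> d y = 0 \<and> u y = 0"
  \<comment> \<open>stepsize safeguard with values in (0,\<infinity>]\<close>
    and Gs_pos: "\<forall>y e. norm e = 1 \<longrightarrow> 0 < Gs y e"
  \<comment> \<open>psi can be truncated\<close>
    and trunc: "can_truncate (Gamma_pt psi) S m \<delta> \<kappa> T"
  \<comment> \<open>algorithm parameters\<close>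
    and params: "0 < \<eta>" "\<eta> < \<eta>1" "\<eta>1 < \<eta>2" "\<eta>2 < 1" "0 < r1" "r1 < 1" "1 < r2"
       "0 < \<Delta>max" "0 < \<gamma>1" "0 < \<gamma>2"
    and eps_seq: "\<forall>i. 0 < \<epsilon> i" "\<forall>i. \<epsilon> (Suc i) < \<epsilon> i" "summable \<epsilon>" "\<forall>i. ereal (\<epsilon> i) \<le> \<delta>"
    and ell_ass: "\<forall>t>0. 0 \<le> ell t \<and> ell t \<le> 1/2" "\<forall>a b. 0 < a \<longrightarrow> a \<le> b \<longrightarrow> ell b \<le> ell a"
       "(ell \<longlongrightarrow> 0) (at_right 0)"
  \<comment> \<open>initialization\<close>
    and init: "0 < \<Delta> 0" "c 0 = (\<lambda>i. 0)"
  \<comment> \<open>the algorithm does not terminate\<close>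
    and g_def: "\<forall>k. g k = u (x k) *\<^sub>R d (x k)"
    and nonterm: "\<forall>k. g k \<noteq> 0"
  \<comment> \<open>Cauchy point\<close>
    and cauchy: "\<forall>k. 0 \<le> aC k \<and> aC k \<le> \<Delta> k / norm (g k) \<and>
          (\<forall>t. 0 \<le> t \<and> t \<le> \<Delta> k / norm (g k) \<longrightarrow>
             tr_model (psi (x k)) (g k) (B k) (- (aC k *\<^sub>R g k))
               \<le> tr_model (psi (x k)) (g k) (B k) (- (t *\<^sub>R g k)))"
    and sC_def: "\<forall>k. sC k = - (aC k *\<^sub>R g k)"
  \<comment> \<open>trial step\<close>
    and step: "\<forall>k. norm (s k) \<le> \<Delta> k \<and>
          tr_model (psi (x k)) (g k) (B k) 0 - tr_model (psi (x k)) (g k) (B k) (s k)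
            \<ge> \<gamma>1 / 2 * norm (g k) * min (\<Delta> k) (\<gamma>2 * norm (g k)) \<and>
          tr_model (psi (x k)) (g k) (B k) 0 - tr_model (psi (x k)) (g k) (B k) (s k)
            \<ge> (1 - ell (norm (s k))) *
              (tr_model (psi (x k)) (g k) (B k) 0 - tr_model (psi (x k)) (g k) (B k) (sC k))"
    and rho1_def: "\<forall>k. \<rho>1 k = (psi (x k) - psi (x k + s k)) /
          (tr_model (psi (x k)) (g k) (B k) 0 - tr_model (psi (x k)) (g k) (B k) (s k))"
  \<comment> \<open>stepsize computation (sf k, \<alpha> k are the final s^k, \<alpha>_k of this computation)\<close>
    and alpha0_def: "\<forall>k. \<alpha>0 k = real_of_ereal (min (Gs (x k) (sgn (s k))) (ereal (norm (s k))))"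
    and sf_def: "\<forall>k. sf k = (if tr_model (psi (x k)) (g k) (B k) 0
                                 - tr_model (psi (x k)) (g k) (B k) (\<alpha>0 k *\<^sub>R sgn (s k))
                               < \<alpha>0 k / (2 * norm (s k)) *
                                 (tr_model (psi (x k)) (g k) (B k) 0
                                   - tr_model (psi (x k)) (g k) (B k) (s k))
                            then sC k else s k)"
    and alpha_def: "\<forall>k. \<alpha> k = real_of_ereal (min (Gs (x k) (sgn (sf k))) (ereal (norm (sf k))))"
    and rho2_def: "\<forall>k. \<rho>2 k = (psi (x k) - psi (x k + \<alpha> k *\<^sub>R sgn (sf k))) /
          (tr_model (psi (x k)) (g k) (B k) 0
            - tr_model (psi (x k)) (g k) (B k) (\<alpha> k *\<^sub>R sgn (sf k)))"
  \<comment> \<open>updates\<close>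
    and upd_succ: "\<forall>k. \<rho>1 k \<ge> \<eta>1 \<longrightarrow> xt k = x k + s k \<and>
          \<Delta> (Suc k) = (if \<rho>1 k > \<eta>2 then min \<Delta>max (r2 * \<Delta> k) else \<Delta> k)"
    and upd_fail: "\<forall>k. \<rho>1 k < \<eta>1 \<longrightarrow>
          \<Delta> (Suc k) = (if \<rho>2 k < \<eta>1 then r1 * \<Delta> k
                        else if \<rho>2 k > \<eta>2 then min \<Delta>max (r2 * \<Delta> k) else \<Delta> k) \<and>
          xt k = (if \<rho>2 k \<ge> \<eta> then x k + \<alpha> k *\<^sub>R sgn (sf k) else x k)"
  \<comment> \<open>truncation step\<close>
    and trunc_step: "\<forall>k. trunc_loop (Gamma_pt psi) S m \<epsilon> T (xt k) (c k) (x (Suc k)) (c (Suc k))"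
  \<comment> \<open>(A.1)\<close>
    and A1: "bdd_below (range psi)"
  \<comment> \<open>(B.1)\<close>
    and B1: "0 < R" "\<forall>k. x k \<in> ball 0 R"
  \<comment> \<open>(B.2)\<close>
    and B2: "0 < \<kappa>B" "\<forall>k. norm (B k) \<le> \<kappa>B"
  \<comment> \<open>(B.3)\<close>
    and B3: "\<forall>r::nat \<Rightarrow> nat. strict_mono r \<and> convergent (\<lambda>l. x (r l)) \<and> (\<lambda>l. \<alpha> (r l)) \<longlonglongrightarrow> 0 \<longrightarrow>
          (\<lambda>l. psi (x (r l) + \<alpha> (r l) *\<^sub>R sgn (sf (r l))) - psi (x (r l))
                 - \<alpha> (r l) * dir_deriv psi (x (r l)) (sgn (sf (r l))))
            \<in> o(\<lambda>l. \<alpha> (r l))"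
  \<comment> \<open>(B.4)\<close>
    and B4: "\<forall>e>0. \<exists>e'>0. \<forall>k. ereal e \<le> Gamma_pt psi (x k) \<longrightarrow> ereal e' \<le> Gs (x k) (sgn (sf k))"
  shows "liminf (\<lambda>k. ereal (norm (g k))) = 0"
proof -
  interpret trust_region_run f phi psi gradf u d Gs S m \<delta> \<kappa> T \<eta> \<eta>1 \<eta>2 r1 r2 \<Delta>max \<gamma>1 \<gamma>2 \<epsilon> ell x \<Delta> c B
    g sC s sf xt aC \<alpha>0 \<alpha> \<rho>1 \<rho>2 R \<kappa>B
    by unfold_locales (rule assms)+
  show ?thesis by (rule liminf_norm_g_eq_0)
qed

end
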